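(* Let $Q$ be an acyclic quiver and let $\mathcal{Q}^\bullet=\{Q^1,\ldots,Q^\ell\}$ be an admissible, ordered, Dynkin subquiver partition of $Q$ such that none of the subquivers $Q^j$ is an orientation of $E_8$. Assume that, for each $Q^j$ of type $E$, all $\mathbf{GL}_\delta$-orbit closures in the spaces $\mathbf{Rep}_\delta(Q^j)$ have only rational singularities. Then the mapping induced by the multifactor $*$-multiplication (left to right) of $\mathcal{H}(Q)$, $$\mathcal{H}(Q^1)\otimes\cdots\otimes\mathcal{H}(Q^\ell)\stackrel{\cong}{\longrightarrow}\mathcal{H}(Q),\qquad f_1\otimes\cdots\otimes f_\ell\mapsto f_1*\cdots*f_\ell,$$ is an isomorphism (of $D$-graded vector spaces).
   Context: Quivers. A quiver $Q$ has a finite vertex set $Q_0$, a finite arrow set $Q_1$, and head and tail maps $h,t:Q_1\to Q_0$. It is acyclic if it has no oriented cycles. Write $[p]=\{1,\ldots,p\}$. A dimension vector is $\gamma=(\gamma(i))_{i\in Q_0}$ with $\gamma(i)\in\mathbb{Z}_{\ge0}$; $D$ is the monoid of dimension vectors of $Q$. $\mathbf{Rep}_\gamma(Q)=\bigoplus_{a\in Q_1}\mathrm{Hom}(\mathbb{C}^{\gamma(ta)},\mathbb{C}^{\gamma(ha)})$ carries the action of $\mathbf{GL}_\gamma=\prod_{i\in Q_0}\mathrm{GL}(\mathbb{C}^{\gamma(i)})$ by $(g_i)\cdot(\phi_a)=(g_{ha}\phi_ag_{ta}^{-1})$. CoHA. All cohomology has rational coefficients. $\mathcal{H}_\gamma(Q)=H^\bullet_{\mathbf{GL}_\gamma}(\mathbf{Rep}_\gamma(Q))$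 is identified with $\bigotimes_{i\in Q_0}\mathbb{Q}[\omega_{i,1},\ldots,\omega_{i,\gamma(i)}]^{\mathfrak{S}_{\gamma(i)}}$ (Chern roots, degree $2$). The cohomological Hall algebra is $\mathcal{H}(Q)=\bigoplus_{\gamma\in D}\mathcal{H}_\gamma(Q)$ with the associative product (Kontsevich–Soibelman), for $f_1\in\mathcal{H}_{\gamma_1}$, $f_2\in\mathcal{H}_{\gamma_2}$, $$f_1*f_2=\sum_{(S_i)_{i\in Q_0}}f_1(S_\bullet)\,f_2(\overline{S_\bullet})\,\frac{\prod_{a\in Q_1}(\omega_{ha,\overline{S_{ha}}}-\omega_{ta,S_{ta}})}{\prod_{i\in Q_0}(\omega_{i,\overline{S_i}}-\omega_{i,S_i})}\in\mathcal{H}_{\gamma_1+\gamma_2},$$ where $S_i$ runs over the $\gamma_1(i)$-element subsets of $[\gamma_1(i)+\gamma_2(i)]$, $\overline{S_i}$ is the complement, $f_1(S_\bullet)$ is $f_1$ evaluated on the $\omega_{i,k}$, $k\in S_i$, $f_2(\overline{S_\bullet})$ is $f_2$ evaluated on the $\omega_{i,k}$, $k\in\overline{S_i}$, and $(\omega_{x,U}-\omega_{y,V})=\prod_{u\in U}\prod_{v\in V}(\omega_{x,u}-\omega_{y,v})$ (equal to $1$ if $U$ or $V$ is empty). Subquiver partitions. A subquiver $Q'$ of $Q$ has $Q'_0\subseteq Q_0$, $Q'_1\subseteq Q_1$. A set $\mathcal{Q}^\bullet=\{Q^1,\ldots,Q^\ell\}$ of subquivers is a subquiver partition if each $Q^j$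 is nonempty and connected and $Q_0$ is the disjoint union of the $Q^j_0$. It is Dynkin if each $Q^j$ is an orientation of a simply-laced Dynkin diagram (type $A$, $D$, $E$). It is admissible if the quiver obtained from $Q$ by contracting each $Q^j$ to a single vertex (its arrows are $Q_1\setminus\bigcup_jQ^j_1$) is acyclic. An admissible one is ordered if for each arrow $a$ of the contracted quiver with $ha=Q^i$, $ta=Q^j$ one has $i<j$. Inclusion of factors. A dimension vector of $Q^j$ is regarded as a dimension vector of $Q$ by extension by zero; then $\mathcal{H}_{\gamma^j}(Q^j)$ and $\mathcal{H}_{\gamma^j}(Q)$ are the same ring of polynomials in $\omega_{i,k}$ ($i\in Q^j_0$), and in this way $\mathcal{H}(Q^j)$ is regarded as a subspace of $\mathcal{H}(Q)$. *)

theory Defs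
  imports
    "HOL-Library.Poly_Mapping"
    "HOL-Library.Product_Lexorder"
    "HOL-Library.Function_Algebras"
    "HOL-Computational_Algebra.Fraction_Field"
    "HOL-Combinatorics.Permutations"
    "Graph_Theory.Digraph_Component"
    "Jordan_Normal_Form.Matrix"
begin

section \<open>Multivariate polynomials\<close>

text \<open>Finitely supported maps from monomials (exponent vectors) to coefficients; the ring structure
  is the convolution product of \<^theory>\<open>HOL-Library.Poly_Mapping\<close>.\<close>

type_synonym ('x, 'c) mpoly = "('x \<Rightarrow>\<^sub>0 nat) \<Rightarrow>\<^sub>0 'c"

definition pconst :: "'c::zero \<Rightarrow> ('x, 'c) mpoly" where
  "pconst c = Poly_Mapping.single 0 c"

definition pvar :: "'x \<Rightarrow> ('x, 'c::zero_neq_one) mpoly" where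
  "pvar v = Poly_Mapping.single (Poly_Mapping.single v 1) 1"

definition polys_in :: "'x set \<Rightarrow> ('x, 'c::zero) mpoly set" where
  "polys_in J = {p. \<forall>m \<in> Poly_Mapping.keys p. Poly_Mapping.keys m \<subseteq> J}"

text \<open>Evaluation at \<open>x\<close> in a commutative ring receiving the coefficients through \<open>h\<close>.\<close>

definition poly_eval :: "('c::zero \<Rightarrow> 'b::comm_ring_1) \<Rightarrow> ('x \<Rightarrow> 'b) \<Rightarrow> ('x, 'c) mpoly \<Rightarrow> 'b" where
  "poly_eval h x p =
     (\<Sum>m \<in> Poly_Mapping.keys p. h (Poly_Mapping.lookup p m) *
        (\<Prod>v \<in> Poly_Mapping.keys m. x v ^ Poly_Mapping.lookup m v))"

section \<open>Quivers and dimension vectors\<close>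

text \<open>A quiver is a \<^locale>\<open>fin_digraph\<close>: loops and parallel arrows are allowed there.\<close>

definition acyclic_quiver :: "('v, 'a) pre_digraph \<Rightarrow> bool" where
  "acyclic_quiver Q \<longleftrightarrow> acyclic (arcs_ends Q)"

text \<open>Dimension vectors vanish off the vertex set, so those of a subquiver are, without any
  coercion, dimension vectors of the ambient quiver.\<close>

definition dimvecs :: "('v, 'a) pre_digraph \<Rightarrow> ('v \<Rightarrow> nat) set" where
  "dimvecs Q = {\<gamma>. \<forall>i. i \<notin> verts Q \<longrightarrow> \<gamma> i = 0}"

section \<open>The cohomological Hall algebra\<close>

text \<open>The variable \<open>(i, k)\<close> is the Chern root \<open>\<omega>\<^bsub>i,k\<^esub>\<close>, \<open>1 \<le> k \<le> \<gamma> i\<close>.\<close>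

definition coha_deg :: "('v, 'a) pre_digraph \<Rightarrow> ('v \<Rightarrow> nat) \<Rightarrow> ('v \<times> nat, rat) mpoly set" where
  "coha_deg Q \<gamma> = {p \<in> polys_in {(i, k). i \<in> verts Q \<and> k \<in> {1..\<gamma> i}}.
     \<forall>\<sigma>. (\<forall>i. \<sigma> i permutes {1..\<gamma> i}) \<longrightarrow>
       poly_eval pconst (\<lambda>(i, k). pvar (i, \<sigma> i k)) p = p}"

text \<open>The direct sum over all dimension vectors: finitely supported families. The multiplication
  of this type provided by \<^theory>\<open>HOL-Library.Poly_Mapping\<close> is not used.\<close>

type_synonym 'v coha = "('v \<Rightarrow> nat) \<Rightarrow>\<^sub>0 ('v \<times> nat, rat) mpoly"

definition coha :: "('v, 'a) pre_digraph \<Rightarrow> 'v coha set" where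
  "coha Q = {F. Poly_Mapping.keys F \<subseteq> dimvecs Q \<and>
     (\<forall>\<gamma> \<in> dimvecs Q. Poly_Mapping.lookup F \<gamma> \<in> coha_deg Q \<gamma>)}"

definition coha_component :: "('v, 'a) pre_digraph \<Rightarrow> ('v \<Rightarrow> nat) \<Rightarrow> 'v coha set" where
  "coha_component Q \<gamma> = Poly_Mapping.single \<gamma> ` coha_deg Q \<gamma>"

definition coha_scale :: "rat \<Rightarrow> 'v coha \<Rightarrow> 'v coha" where
  "coha_scale c = Poly_Mapping.map (\<lambda>p. pconst c * p)"

text \<open>\<open>f\<close> evaluated on the \<open>\<omega>\<^bsub>i,k\<^esub>\<close> with \<open>k \<in> S i\<close>, taken in increasing order.\<close>

definition eval_on :: "('v \<Rightarrow> nat set) \<Rightarrow> ('v \<times> nat, rat) mpoly \<Rightarrow> ('v \<times> nat, rat) mpoly" where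
  "eval_on S f = poly_eval pconst (\<lambda>(i, k). pvar (i, sorted_list_of_set (S i) ! (k - 1))) f"

definition var_diff :: "'v \<Rightarrow> nat set \<Rightarrow> 'v \<Rightarrow> nat set \<Rightarrow> ('v \<times> nat, rat) mpoly" where
  "var_diff x U y V = (\<Prod>u \<in> U. \<Prod>v \<in> V. pvar (x, u) - pvar (y, v))"

definition coha_subsets ::
    "('v, 'a) pre_digraph \<Rightarrow> ('v \<Rightarrow> nat) \<Rightarrow> ('v \<Rightarrow> nat) \<Rightarrow> ('v \<Rightarrow> nat set) set" where
  "coha_subsets Q \<gamma>1 \<gamma>2 =
     (\<Pi>\<^sub>E i \<in> verts Q. {T. T \<subseteq> {1..\<gamma>1 i + \<gamma>2 i} \<and> card T = \<gamma>1 i})"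

text \<open>The sum is formed in the field of rational functions; \<open>THE\<close> picks the polynomial it equals.
  The order on the vertex type serves only to make the polynomial ring an instance of
  \<^class>\<open>idom\<close> in the library, which the fraction field requires.\<close>

definition coha_shuffle :: "('v::linorder, 'a) pre_digraph \<Rightarrow> ('v \<Rightarrow> nat) \<Rightarrow> ('v \<Rightarrow> nat) \<Rightarrow>
    ('v \<times> nat, rat) mpoly \<Rightarrow> ('v \<times> nat, rat) mpoly \<Rightarrow> ('v \<times> nat, rat) mpoly" where
  "coha_shuffle Q \<gamma>1 \<gamma>2 f1 f2 = (THE h. Fraction_Field.Fract h 1 =
     (\<Sum>S \<in> coha_subsets Q \<gamma>1 \<gamma>2.
        let S' = (\<lambda>i. {1..\<gamma>1 i + \<gamma>2 i} - S i) in
        Fraction_Field.Fract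
          (eval_on S f1 * eval_on S' f2 *
             (\<Prod>a \<in> arcs Q. var_diff (head Q a) (S' (head Q a)) (tail Q a) (S (tail Q a))))
          (\<Prod>i \<in> verts Q. var_diff i (S' i) i (S i))))"

definition coha_mult :: "('v::linorder, 'a) pre_digraph \<Rightarrow> 'v coha \<Rightarrow> 'v coha \<Rightarrow> 'v coha" where
  "coha_mult Q F G = (\<Sum>\<gamma>1 \<in> Poly_Mapping.keys F. \<Sum>\<gamma>2 \<in> Poly_Mapping.keys G.
     Poly_Mapping.single (\<gamma>1 + \<gamma>2)
       (coha_shuffle Q \<gamma>1 \<gamma>2 (Poly_Mapping.lookup F \<gamma>1) (Poly_Mapping.lookup G \<gamma>2)))"

text \<open>The empty product is the unit \<open>1\<close> in dimension vector \<open>0\<close>; it only occurs for the empty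
  quiver.\<close>

fun coha_multifactor :: "('v::linorder, 'a) pre_digraph \<Rightarrow> 'v coha list \<Rightarrow> 'v coha" where
  "coha_multifactor Q [] = Poly_Mapping.single 0 1"
| "coha_multifactor Q (f # fs) = foldl (coha_mult Q) f fs"

section \<open>Subquiver partitions\<close>

text \<open>A partition is given as the list of its members, the position in the list being the index.
  Members are nonempty, which is part of \<^const>\<open>Digraph_Component.connected\<close>.\<close>

definition subquiver_partition ::
    "('v, 'a) pre_digraph \<Rightarrow> ('v, 'a) pre_digraph list \<Rightarrow> bool" where
  "subquiver_partition Q Qs \<longleftrightarrow>
     (\<forall>R \<in> set Qs. subgraph R Q \<and> Digraph_Component.connected R) \<and>
     (\<Union>R \<in> set Qs. verts R) = verts Q \<and>
     (\<forall>i < length Qs. \<forall>j < length Qs. i \<noteq> j \<longrightarrow> verts (Qs ! i) \<inter> verts (Qs ! j) = {})"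

definition block_of :: "('v, 'a) pre_digraph list \<Rightarrow> 'v \<Rightarrow> ('v, 'a) pre_digraph" where
  "block_of Qs v = (THE R. R \<in> set Qs \<and> v \<in> verts R)"

definition contracted_quiver :: "('v, 'a) pre_digraph \<Rightarrow> ('v, 'a) pre_digraph list \<Rightarrow>
    (('v, 'a) pre_digraph, 'a) pre_digraph" where
  "contracted_quiver Q Qs =
     \<lparr> verts = set Qs, arcs = arcs Q - (\<Union>R \<in> set Qs. arcs R),
       tail = (\<lambda>a. block_of Qs (tail Q a)), head = (\<lambda>a. block_of Qs (head Q a)) \<rparr>"

definition admissible_partition ::
    "('v, 'a) pre_digraph \<Rightarrow> ('v, 'a) pre_digraph list \<Rightarrow> bool" where
  "admissible_partition Q Qs \<longleftrightarrow> acyclic_quiver (contracted_quiver Q Qs)"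

definition ordered_partition ::
    "('v, 'a) pre_digraph \<Rightarrow> ('v, 'a) pre_digraph list \<Rightarrow> bool" where
  "ordered_partition Q Qs \<longleftrightarrow>
     (\<forall>a \<in> arcs (contracted_quiver Q Qs). \<forall>i < length Qs. \<forall>j < length Qs.
        head (contracted_quiver Q Qs) a = Qs ! i \<and> tail (contracted_quiver Q Qs) a = Qs ! j
          \<longrightarrow> i < j)"

datatype dynkin = DynA nat | DynD nat | DynE nat

fun is_dynkin :: "dynkin \<Rightarrow> bool" where
  "is_dynkin (DynA n) \<longleftrightarrow> n \<ge> 1"
| "is_dynkin (DynD n) \<longleftrightarrow> n \<ge> 4"
| "is_dynkin (DynE n) \<longleftrightarrow> n \<in> {6, 7, 8}"

fun dynkin_rank :: "dynkin \<Rightarrow> nat" where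
  "dynkin_rank (DynA n) = n"
| "dynkin_rank (DynD n) = n"
| "dynkin_rank (DynE n) = n"

text \<open>Edges of the diagrams on the nodes \<open>1, \<dots>, n\<close>, labelled as in Bourbaki.\<close>

fun dynkin_edges :: "dynkin \<Rightarrow> nat set set" where
  "dynkin_edges (DynA n) = {{i, i + 1} | i. 1 \<le> i \<and> i < n}"
| "dynkin_edges (DynD n) = {{i, i + 1} | i. 1 \<le> i \<and> i < n - 1} \<union> {{n - 2, n}}"
| "dynkin_edges (DynE n) = {{i, i + 1} | i. 3 \<le> i \<and> i < n} \<union> {{1, 3}, {2, 4}}"

definition orientation_of :: "('v, 'a) pre_digraph \<Rightarrow> dynkin \<Rightarrow> bool" where
  "orientation_of R t \<longleftrightarrow>
     (\<exists>\<nu>. bij_betw \<nu> {1..dynkin_rank t} (verts R) \<and>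
          bij_betw (\<lambda>a. {tail R a, head R a}) (arcs R) ((`) \<nu> ` dynkin_edges t))"

definition dynkin_partition :: "('v, 'a) pre_digraph list \<Rightarrow> bool" where
  "dynkin_partition Qs \<longleftrightarrow> (\<forall>R \<in> set Qs. \<exists>t. is_dynkin t \<and> orientation_of R t)"

definition of_type_E :: "('v, 'a) pre_digraph \<Rightarrow> bool" where
  "of_type_E R \<longleftrightarrow> (\<exists>n. is_dynkin (DynE n) \<and> orientation_of R (DynE n))"

section \<open>Complex affine varieties and rational singularities\<close>

text \<open>Affine space on a finite set \<open>J\<close> of coordinates; points are extended by \<open>0\<close>.\<close>

definition affine_space :: "'x set \<Rightarrow> ('x \<Rightarrow> complex) set" where
  "affine_space J = {z. \<forall>j. j \<notin> J \<longrightarrow> z j = 0}"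

definition zero_locus :: "'x set \<Rightarrow> ('x, complex) mpoly set \<Rightarrow> ('x \<Rightarrow> complex) set" where
  "zero_locus J F = {z \<in> affine_space J. \<forall>f \<in> F. poly_eval id z f = 0}"

definition zariski_closed :: "'x set \<Rightarrow> ('x \<Rightarrow> complex) set \<Rightarrow> bool" where
  "zariski_closed J Z \<longleftrightarrow> (\<exists>F \<subseteq> polys_in J. Z = zero_locus J F)"

definition zariski_closure :: "'x set \<Rightarrow> ('x \<Rightarrow> complex) set \<Rightarrow> ('x \<Rightarrow> complex) set" where
  "zariski_closure J S = \<Inter>{Z. zariski_closed J Z \<and> S \<subseteq> Z}"

definition zariski_irreducible :: "'x set \<Rightarrow> ('x \<Rightarrow> complex) set \<Rightarrow> bool" where
  "zariski_irreducible J Z \<longleftrightarrow> Z \<noteq> {} \<and>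
     (\<forall>A B. zariski_closed J A \<and> zariski_closed J B \<and> Z \<subseteq> A \<union> B \<longrightarrow> Z \<subseteq> A \<or> Z \<subseteq> B)"

definition krull_dim :: "'x set \<Rightarrow> ('x \<Rightarrow> complex) set \<Rightarrow> nat" where
  "krull_dim J Z = Sup {n. \<exists>C :: nat \<Rightarrow> ('x \<Rightarrow> complex) set.
     (\<forall>i \<le> n. zariski_closed J (C i) \<and> zariski_irreducible J (C i) \<and> C i \<subseteq> Z) \<and>
     (\<forall>i < n. C i \<subset> C (Suc i))}"

text \<open>The common kernel of the differentials at \<open>p\<close> of the polynomials vanishing on \<open>Z\<close>.\<close>

definition tangent_space ::
    "'x set \<Rightarrow> ('x \<Rightarrow> complex) set \<Rightarrow> ('x \<Rightarrow> complex) \<Rightarrow> ('x \<Rightarrow> complex) set" where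
  "tangent_space J Z p = {v \<in> affine_space J.
     \<forall>f \<in> polys_in J. (\<forall>z \<in> Z. poly_eval id z f = 0) \<longrightarrow>
       ((\<lambda>t. poly_eval id (\<lambda>j. p j + t * v j) f) has_field_derivative 0) (at 0)}"

definition smooth_irreducible :: "'x set \<Rightarrow> ('x \<Rightarrow> complex) set \<Rightarrow> bool" where
  "smooth_irreducible J Z \<longleftrightarrow> (\<forall>p \<in> Z.
     vector_space.dim (\<lambda>(c::complex) v j. c * v j) (tangent_space J Z p) = krull_dim J Z)"

text \<open>Closed subsets of \<open>A\<^sup>I \<times> P\<^sup>n\<close> are represented by their cones in
  \<open>A\<^sup>I \<times> (A\<^bsup>n+1\<^esup> - {0})\<close>, with coordinates \<open>Inl i\<close> (\<open>i \<in> I\<close>) and \<open>Inr k\<close> (\<open>k \<le> n\<close>). They are cut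
  out by polynomials homogeneous in the \<open>Inr\<close> variables.\<close>

definition relative_coords :: "'x set \<Rightarrow> nat \<Rightarrow> ('x + nat) set" where
  "relative_coords I n = Inl ` I \<union> Inr ` {..n}"

definition relative_homogeneous :: "nat \<Rightarrow> nat \<Rightarrow> ('x + nat, complex) mpoly \<Rightarrow> bool" where
  "relative_homogeneous n d f \<longleftrightarrow>
     (\<forall>m \<in> Poly_Mapping.keys f. (\<Sum>k \<le> n. Poly_Mapping.lookup m (Inr k)) = d)"

definition relative_closed :: "'x set \<Rightarrow> nat \<Rightarrow> ('x + nat \<Rightarrow> complex) set \<Rightarrow> bool" where
  "relative_closed I n Y \<longleftrightarrow>
     (\<exists>F \<subseteq> {f \<in> polys_in (relative_coords I n). \<exists>d. relative_homogeneous n d f}.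
        Y = {z \<in> zero_locus (relative_coords I n) F. \<exists>k \<le> n. z (Inr k) \<noteq> 0})"

text \<open>The projection \<open>Y \<rightarrow> X\<close> is an isomorphism over the nonempty open subset \<open>h \<noteq> 0\<close> of \<open>X\<close>, with
  inverse \<open>x \<mapsto> (x, [g\<^sub>0 x : \<dots> : g\<^sub>n x])\<close>. For irreducible \<open>X\<close>, every regular map from an open
  subset of \<open>X\<close> to \<open>P\<^sup>n\<close> has this form on a smaller one.\<close>

definition birational_projection ::
    "'x set \<Rightarrow> nat \<Rightarrow> ('x + nat \<Rightarrow> complex) set \<Rightarrow> ('x \<Rightarrow> complex) set \<Rightarrow> bool" where
  "birational_projection I n Y X \<longleftrightarrow>
     (\<exists>h \<in> polys_in I. \<exists>g. (\<forall>k \<le> n. g k \<in> polys_in I) \<and>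
        (\<exists>x \<in> X. poly_eval id x h \<noteq> 0) \<and>
        (\<forall>x \<in> X. poly_eval id x h \<noteq> 0 \<longrightarrow>
           (\<exists>k \<le> n. poly_eval id x (g k) \<noteq> 0) \<and>
           (\<forall>z \<in> affine_space (relative_coords I n). z \<circ> Inl = x \<longrightarrow>
              (z \<in> Y \<longleftrightarrow> (\<exists>c. c \<noteq> 0 \<and> (\<forall>k \<le> n. z (Inr k) = c * poly_eval id x (g k)))))))"

text \<open>A resolution \<open>Y \<rightarrow> X\<close>, projective since \<open>Y\<close> is closed in \<open>A\<^sup>I \<times> P\<^sup>n\<close>. Smoothness is
  tested on the standard affine charts \<open>z (Inr k) = 1\<close>.\<close>

definition projective_resolution ::
    "'x set \<Rightarrow> nat \<Rightarrow> ('x + nat \<Rightarrow> complex) set \<Rightarrow> ('x \<Rightarrow> complex) set \<Rightarrow> bool" where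
  "projective_resolution I n Y X \<longleftrightarrow>
     relative_closed I n Y \<and>
     zariski_irreducible (relative_coords I n) Y \<and>
     (\<forall>k \<le> n. smooth_irreducible (relative_coords I n) {z \<in> Y. z (Inr k) = 1}) \<and>
     (\<forall>z \<in> Y. z \<circ> Inl \<in> X) \<and>
     birational_projection I n Y X"

text \<open>The open subset of \<open>Y\<close> where all homogeneous coordinates with index in \<open>K\<close> are nonzero, and
  the regular functions on it (extended by \<open>0\<close>): homogeneous fractions of degree \<open>0\<close>.\<close>

definition chart :: "('x + nat \<Rightarrow> complex) set \<Rightarrow> nat set \<Rightarrow> ('x + nat \<Rightarrow> complex) set" where
  "chart Y K = {z \<in> Y. \<forall>k \<in> K. z (Inr k) \<noteq> 0}"

definition regular_functions :: "'x set \<Rightarrow> nat \<Rightarrow> ('x + nat \<Rightarrow> complex) set \<Rightarrow> nat set \<Rightarrow>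
    (('x + nat \<Rightarrow> complex) \<Rightarrow> complex) set" where
  "regular_functions I n Y K = {s. \<exists>N. \<exists>p \<in> polys_in (relative_coords I n).
     relative_homogeneous n (N * card K) p \<and>
     (\<forall>z. s z = (if z \<in> chart Y K then poly_eval id z p / (\<Prod>k \<in> K. z (Inr k)) ^ N else 0))}"

text \<open>The Cech complex of the structure sheaf of \<open>Y\<close> for the standard affine cover.\<close>

definition cech_cochains :: "'x set \<Rightarrow> nat \<Rightarrow> ('x + nat \<Rightarrow> complex) set \<Rightarrow> nat \<Rightarrow>
    (nat set \<Rightarrow> ('x + nat \<Rightarrow> complex) \<Rightarrow> complex) set" where
  "cech_cochains I n Y q =
     {c. \<forall>K. K \<subseteq> {..n} \<and> card K = q + 1 \<longrightarrow> c K \<in> regular_functions I n Y K}"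

definition cech_d :: "(nat set \<Rightarrow> ('x + nat \<Rightarrow> complex) \<Rightarrow> complex) \<Rightarrow>
    nat set \<Rightarrow> ('x + nat \<Rightarrow> complex) \<Rightarrow> complex" where
  "cech_d c K z = (\<Sum>k \<in> K. (- 1) ^ card {l \<in> K. l < k} * c (K - {k}) z)"

definition cech_cocycle :: "nat \<Rightarrow> ('x + nat \<Rightarrow> complex) set \<Rightarrow> nat \<Rightarrow>
    (nat set \<Rightarrow> ('x + nat \<Rightarrow> complex) \<Rightarrow> complex) \<Rightarrow> bool" where
  "cech_cocycle n Y q c \<longleftrightarrow>
     (\<forall>K. K \<subseteq> {..n} \<and> card K = q + 2 \<longrightarrow> (\<forall>z \<in> chart Y K. cech_d c K z = 0))"

text \<open>\<open>X\<close> is affine, so for \<open>f : Y \<rightarrow> X\<close> the condition that \<open>O\<^sub>X \<rightarrow> f\<^sub>* O\<^sub>Y\<close> is an isomorphism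
  (that is, \<open>X\<close> is normal) says that global regular functions on \<open>Y\<close> come from \<open>X\<close>, and
  \<open>R\<^sup>q f\<^sub>* O\<^sub>Y = 0\<close> says that the \<open>q\<close>-th Cech cohomology vanishes. Whether this holds does not
  depend on the resolution.\<close>

definition rational_singularities :: "'x set \<Rightarrow> ('x \<Rightarrow> complex) set \<Rightarrow> bool" where
  "rational_singularities I X \<longleftrightarrow>
     zariski_closed I X \<and> zariski_irreducible I X \<and>
     (\<exists>n Y. projective_resolution I n Y X \<and>
        (\<forall>c \<in> cech_cochains I n Y 0. cech_cocycle n Y 0 c \<longrightarrow>
           (\<exists>p \<in> polys_in I. \<forall>k \<le> n. \<forall>z \<in> chart Y {k}. c {k} z = poly_eval id (z \<circ> Inl) p)) \<and>
        (\<forall>q. \<forall>c \<in> cech_cochains I n Y (Suc q). cech_cocycle n Y (Suc q) c \<longrightarrow>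
           (\<exists>b \<in> cech_cochains I n Y q. \<forall>K. K \<subseteq> {..n} \<and> card K = q + 2 \<longrightarrow>
              (\<forall>z \<in> chart Y K. c K z = cech_d b K z))))"

section \<open>Representation spaces and orbit closures\<close>

definition quiver_reps ::
    "('v, 'a) pre_digraph \<Rightarrow> ('v \<Rightarrow> nat) \<Rightarrow> ('a \<Rightarrow> complex mat) set" where
  "quiver_reps R \<delta> = (\<Pi>\<^sub>E a \<in> arcs R. carrier_mat (\<delta> (head R a)) (\<delta> (tail R a)))"

definition quiver_GL ::
    "('v, 'a) pre_digraph \<Rightarrow> ('v \<Rightarrow> nat) \<Rightarrow> ('v \<Rightarrow> complex mat) set" where
  "quiver_GL R \<delta> = (\<Pi>\<^sub>E i \<in> verts R. {A \<in> carrier_mat (\<delta> i) (\<delta> i). invertible_mat A})"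

definition quiver_orbit :: "('v, 'a) pre_digraph \<Rightarrow> ('v \<Rightarrow> nat) \<Rightarrow> ('a \<Rightarrow> complex mat) \<Rightarrow>
    ('a \<Rightarrow> complex mat) set" where
  "quiver_orbit R \<delta> \<phi> = {\<psi> \<in> quiver_reps R \<delta>.
     \<exists>g \<in> quiver_GL R \<delta>. \<exists>g' \<in> quiver_GL R \<delta>.
       (\<forall>i \<in> verts R. inverts_mat (g i) (g' i) \<and> inverts_mat (g' i) (g i)) \<and>
       (\<forall>a \<in> arcs R. \<psi> a = g (head R a) * \<phi> a * g' (tail R a))}"

text \<open>The space of representations as an affine space with the matrix entries as coordinates.\<close>

definition rep_coords ::
    "('v, 'a) pre_digraph \<Rightarrow> ('v \<Rightarrow> nat) \<Rightarrow> ('a \<times> nat \<times> nat) set" where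
  "rep_coords R \<delta> = {(a, r, s). a \<in> arcs R \<and> r < \<delta> (head R a) \<and> s < \<delta> (tail R a)}"

definition rep_point :: "('v, 'a) pre_digraph \<Rightarrow> ('v \<Rightarrow> nat) \<Rightarrow> ('a \<Rightarrow> complex mat) \<Rightarrow>
    'a \<times> nat \<times> nat \<Rightarrow> complex" where
  "rep_point R \<delta> \<phi> = (\<lambda>(a, r, s). if (a, r, s) \<in> rep_coords R \<delta> then \<phi> a $$ (r, s) else 0)"

definition orbit_closure :: "('v, 'a) pre_digraph \<Rightarrow> ('v \<Rightarrow> nat) \<Rightarrow> ('a \<Rightarrow> complex mat) \<Rightarrow>
    ('a \<times> nat \<times> nat \<Rightarrow> complex) set" where
  "orbit_closure R \<delta> \<phi> =
     zariski_closure (rep_coords R \<delta>) (rep_point R \<delta> ` quiver_orbit R \<delta> \<phi>)"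

section \<open>Tensor products of rational vector spaces\<close>

text \<open>For a list \<open>Vs\<close> of subspaces of a rational vector space with scalar multiplication \<open>sc\<close>, the
  tensor product of its members is the free vector space on the tuples \<open>listset Vs\<close> modulo the
  multilinearity relations. Its elements are cosets.\<close>

definition free_scale :: "rat \<Rightarrow> ('k \<Rightarrow>\<^sub>0 rat) \<Rightarrow> ('k \<Rightarrow>\<^sub>0 rat)" where
  "free_scale c = Poly_Mapping.map ((*) c)"

definition free_space :: "'k set \<Rightarrow> ('k \<Rightarrow>\<^sub>0 rat) set" where
  "free_space B = {x. Poly_Mapping.keys x \<subseteq> B}"

definition tensor_relations :: "(rat \<Rightarrow> 'b::ab_group_add \<Rightarrow> 'b) \<Rightarrow> 'b set list \<Rightarrow>
    ('b list \<Rightarrow>\<^sub>0 rat) set" where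
  "tensor_relations sc Vs = module.span free_scale
     ({Poly_Mapping.single (fs[j := u + v]) 1 - Poly_Mapping.single (fs[j := u]) 1
         - Poly_Mapping.single (fs[j := v]) 1 | fs j u v.
         fs \<in> listset Vs \<and> j < length Vs \<and> u \<in> Vs ! j \<and> v \<in> Vs ! j} \<union>
      {Poly_Mapping.single (fs[j := sc c u]) 1 - Poly_Mapping.single (fs[j := u]) c | fs j c u.
         fs \<in> listset Vs \<and> j < length Vs \<and> u \<in> Vs ! j})"

definition tensor_class :: "(rat \<Rightarrow> 'b::ab_group_add \<Rightarrow> 'b) \<Rightarrow> 'b set list \<Rightarrow>
    ('b list \<Rightarrow>\<^sub>0 rat) \<Rightarrow> ('b list \<Rightarrow>\<^sub>0 rat) set" where
  "tensor_class sc Vs x = {x + r | r. r \<in> tensor_relations sc Vs}"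

definition tensor_space :: "(rat \<Rightarrow> 'b::ab_group_add \<Rightarrow> 'b) \<Rightarrow> 'b set list \<Rightarrow>
    ('b list \<Rightarrow>\<^sub>0 rat) set set" where
  "tensor_space sc Vs = tensor_class sc Vs ` free_space (listset Vs)"

definition pure_tensor :: "(rat \<Rightarrow> 'b::ab_group_add \<Rightarrow> 'b) \<Rightarrow> 'b set list \<Rightarrow> 'b list \<Rightarrow>
    ('b list \<Rightarrow>\<^sub>0 rat) set" where
  "pure_tensor sc Vs fs = tensor_class sc Vs (Poly_Mapping.single fs 1)"

definition tensor_plus ::
    "('b list \<Rightarrow>\<^sub>0 rat) set \<Rightarrow> ('b list \<Rightarrow>\<^sub>0 rat) set \<Rightarrow> ('b list \<Rightarrow>\<^sub>0 rat) set" where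
  "tensor_plus T U = {x + y | x y. x \<in> T \<and> y \<in> U}"

definition tensor_scale :: "(rat \<Rightarrow> 'b::ab_group_add \<Rightarrow> 'b) \<Rightarrow> 'b set list \<Rightarrow> rat \<Rightarrow>
    ('b list \<Rightarrow>\<^sub>0 rat) set \<Rightarrow> ('b list \<Rightarrow>\<^sub>0 rat) set" where
  "tensor_scale sc Vs c T = {free_scale c x + r | x r. x \<in> T \<and> r \<in> tensor_relations sc Vs}"

text \<open>The map induced on cosets by the linear extension of a map \<open>\<mu>\<close> on tuples. That \<open>\<mu>\<close> respects
  the multilinearity relations, so that the linear extension is constant on each coset, is not
  assumed in this definition.\<close>

definition linear_extension ::
    "(rat \<Rightarrow> 'c::comm_monoid_add \<Rightarrow> 'c) \<Rightarrow> ('k \<Rightarrow> 'c) \<Rightarrow> ('k \<Rightarrow>\<^sub>0 rat) \<Rightarrow> 'c" where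
  "linear_extension sc \<mu> x = (\<Sum>k \<in> Poly_Mapping.keys x. sc (Poly_Mapping.lookup x k) (\<mu> k))"

definition tensor_induced ::
    "(rat \<Rightarrow> 'c::comm_monoid_add \<Rightarrow> 'c) \<Rightarrow> ('b list \<Rightarrow> 'c) \<Rightarrow> ('b list \<Rightarrow>\<^sub>0 rat) set \<Rightarrow> 'c" where
  "tensor_induced sc \<mu> T = the_elem (linear_extension sc \<mu> ` T)"

definition coha_tensor :: "('v, 'a) pre_digraph list \<Rightarrow> ('v coha list \<Rightarrow>\<^sub>0 rat) set set" where
  "coha_tensor Qs = tensor_space coha_scale (map coha Qs)"

definition coha_mult_map :: "('v::linorder, 'a) pre_digraph \<Rightarrow>
    ('v coha list \<Rightarrow>\<^sub>0 rat) set \<Rightarrow> 'v coha" where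
  "coha_mult_map Q = tensor_induced coha_scale (coha_multifactor Q)"

text \<open>The degree \<open>\<gamma>\<close> part is spanned by tensors of homogeneous elements with degrees adding up
  to \<open>\<gamma>\<close>.\<close>

definition coha_tensor_component ::
    "('v, 'a) pre_digraph list \<Rightarrow> ('v \<Rightarrow> nat) \<Rightarrow> ('v coha list \<Rightarrow>\<^sub>0 rat) set set" where
  "coha_tensor_component Qs \<gamma> = tensor_class coha_scale (map coha Qs) `
     free_space {fs. \<exists>\<gamma>s. length \<gamma>s = length Qs \<and> sum_list \<gamma>s = \<gamma> \<and>
       (\<forall>j < length Qs. \<gamma>s ! j \<in> dimvecs (Qs ! j)) \<and>
       fs \<in> listset (map2 coha_component Qs \<gamma>s)}"

text \<open>A linear bijection from the tensor product of the factors onto \<open>coha Q\<close> carrying each graded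
  piece onto the corresponding one.\<close>

definition coha_graded_iso :: "('v, 'a) pre_digraph \<Rightarrow> ('v, 'a) pre_digraph list \<Rightarrow>
    (('v coha list \<Rightarrow>\<^sub>0 rat) set \<Rightarrow> 'v coha) \<Rightarrow> bool" where
  "coha_graded_iso Q Qs \<Phi> \<longleftrightarrow>
     (\<forall>T \<in> coha_tensor Qs. \<forall>U \<in> coha_tensor Qs. \<Phi> (tensor_plus T U) = \<Phi> T + \<Phi> U) \<and>
     (\<forall>c. \<forall>T \<in> coha_tensor Qs.
        \<Phi> (tensor_scale coha_scale (map coha Qs) c T) = coha_scale c (\<Phi> T)) \<and>
     bij_betw \<Phi> (coha_tensor Qs) (coha Q) \<and>
     (\<forall>\<gamma> \<in> dimvecs Q. \<Phi> ` coha_tensor_component Qs \<gamma> = coha_component Q \<gamma>)"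

end

theory Submission
  imports Defs
begin

text \<open>
  The blocks have pairwise disjoint vertex sets, so in a product of elements taken from two different
  blocks at each vertex one of the two dimensions is \<open>0\<close>. The shuffle sum then has exactly one summand, and
  its denominator is \<open>1\<close>. Its numerator could only acquire a factor from an arrow leading from the
  earlier block to the later one, and in an ordered partition all arrows between blocks point the
  other way. Hence the shuffle product of elements of the blocks, taken in the given order, is the
  ordinary product of polynomials, with dimension vectors added (\<open>coha_mult_disjoint\<close>,
  \<open>coha_multifactor_disjoint\<close>, \<open>ordered_partition_arcs\<close>). In the two-level representation of families
  this is the convolution product, so that the multifactor product becomes \<^const>\<open>prod_list\<close> in a
  commutative ring.

  The claim is thus the decomposition of invariants under a product group: every dimension vector
  of \<open>Q\<close> is in a unique way a sum of dimension vectors of the blocks, and the ring of invariants of a product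
  of symmetric groups acting on separate sets of variables is the tensor product of the rings of
  invariants of the factors. The proof exhibits an inverse. The Reynolds operator (\<open>symmetric_part\<close>) is the
  identity on symmetric families, and it sends a monomial to the product of the averages of its
  restrictions to the blocks (\<open>symmetrized_disjoint_sum\<close>, \<open>prod_list_symmetric_tuple\<close>). Sending each
  monomial to the pure tensor of these averages defines the map \<open>splitting\<close> from families to formal
  combinations of tuples. Multiplying after splitting is the Reynolds operator
  (\<open>coha_product_splitting\<close>), which gives surjectivity. Splitting after multiplying is the
  identity modulo the tensor relations (\<open>splitting_coha_product\<close>), which gives injectivity; by
  multilinearity this has to be verified only for tuples of monomials (\<open>multilinear_induct\<close>). Both maps
  respect the dimension vector.
\<close>

section \<open>Linear extensions\<close>

lemma coha_scale_conv_mult: "coha_scale c F = Poly_Mapping.single 0 (pconst c) * F"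
  by (simp add: coha_scale_def mult_map_scale_conv_mult)

lemma free_scale_conv_mult:
  "free_scale c (x :: 'k::comm_monoid_add \<Rightarrow>\<^sub>0 rat) = Poly_Mapping.single 0 c * x"
  by (simp add: free_scale_def mult_map_scale_conv_mult)

lemma lookup_free_scale [simp]:
  "Poly_Mapping.lookup (free_scale c x) k = c * Poly_Mapping.lookup x k"
  by (simp add: free_scale_def Poly_Mapping.map.rep_eq when_def)

lemma lookup_coha_scale [simp]:
  "Poly_Mapping.lookup (coha_scale c F) \<gamma> = free_scale c (Poly_Mapping.lookup F \<gamma>)"
  by (simp add: coha_scale_def Poly_Mapping.map.rep_eq when_def free_scale_conv_mult pconst_def)

lemma keys_free_scale: "Poly_Mapping.keys (free_scale c x) \<subseteq> Poly_Mapping.keys x"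
  by (auto simp: in_keys_iff)

interpretation free: Modules.module free_scale
  by unfold_locales (auto intro!: poly_mapping_eqI simp: lookup_add algebra_simps)

interpretation coha: Modules.module coha_scale
  by unfold_locales (auto intro!: poly_mapping_eqI simp: lookup_add algebra_simps)

lemma keys_coha_scale: "Poly_Mapping.keys (coha_scale c F) \<subseteq> Poly_Mapping.keys F"
  by (auto simp: in_keys_iff)

lemma free_scale_single [simp]:
  "free_scale c (Poly_Mapping.single k d) = Poly_Mapping.single k (c * d)"
  by (rule poly_mapping_eqI) (simp add: lookup_single when_def)

lemma coha_scale_single:
  "coha_scale c (Poly_Mapping.single \<gamma> p) = Poly_Mapping.single \<gamma> (free_scale c p)"
  by (rule poly_mapping_eqI) (simp add: lookup_single when_def)

lemma coha_scale_mult: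
  "coha_scale c F * G = coha_scale c (F * G)" "F * coha_scale c G = coha_scale c (F * G)"
  by (simp_all add: coha_scale_conv_mult ac_simps)

lemma single_sum:
  "Poly_Mapping.single k (\<Sum>i\<in>I. f i) = (\<Sum>i\<in>I. Poly_Mapping.single k (f i))"
  by (induction I rule: infinite_finite_induct) (simp_all add: single_add)

lemma poly_mapping_sum_single:
  "(\<Sum>k\<in>Poly_Mapping.keys x. Poly_Mapping.single k (Poly_Mapping.lookup x k)) = x"
  by (rule poly_mapping_eqI) (auto simp: lookup_sum lookup_single when_def in_keys_iff)


lemma linear_extension_superset:
  assumes "Modules.module sc" "finite S" "Poly_Mapping.keys x \<subseteq> S"
  shows "linear_extension sc \<mu> x = (\<Sum>k\<in>S. sc (Poly_Mapping.lookup x k) (\<mu> k))"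
  unfolding linear_extension_def using assms(2,3)
  by (intro sum.mono_neutral_left) (auto simp: in_keys_iff module.scale_zero_left[OF assms(1)])

lemma linear_extension_add:
  assumes "Modules.module sc"
  shows "linear_extension sc \<mu> (x + y) = linear_extension sc \<mu> x + linear_extension sc \<mu> y"
proof -
  let ?S = "Poly_Mapping.keys x \<union> Poly_Mapping.keys y"
  have "linear_extension sc \<mu> z = (\<Sum>k\<in>?S. sc (Poly_Mapping.lookup z k) (\<mu> k))"
    if "Poly_Mapping.keys z \<subseteq> ?S" for z
    using that by (intro linear_extension_superset[OF assms]) auto
  from this[of x] this[of y] this[of "x + y"] show ?thesis
    by (simp add: keys_add lookup_add module.scale_left_distrib[OF assms] sum.distrib)
qed

lemma linear_extension_scale:
  assumes "Modules.module sc"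
  shows "linear_extension sc \<mu> (free_scale c x) = sc c (linear_extension sc \<mu> x)"
proof -
  have "linear_extension sc \<mu> (free_scale c x) =
      (\<Sum>k\<in>Poly_Mapping.keys x. sc (Poly_Mapping.lookup (free_scale c x) k) (\<mu> k))"
    by (rule linear_extension_superset[OF assms]) (auto simp: in_keys_iff)
  also have "\<dots> = sc c (linear_extension sc \<mu> x)"
    by (simp add: linear_extension_def module.scale_sum_right[OF assms] module.scale_scale[OF assms])
  finally show ?thesis .
qed

lemma linear_extension_single:
  assumes "Modules.module sc"
  shows "linear_extension sc \<mu> (Poly_Mapping.single k c) = sc c (\<mu> k)"
  using linear_extension_superset[OF assms, of "{k}" "Poly_Mapping.single k c" \<mu>] by simp

lemma module_hom_linear_extension:
  "Modules.module sc \<Longrightarrow> module_hom free_scale sc (linear_extension sc \<mu>)"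
  by (simp add: Modules.module_hom_def Modules.module_hom_axioms_def free.module_axioms
      linear_extension_add linear_extension_scale)

text \<open>The elements of \<open>'v coha\<close> are two-level families: a dimension vector, then a monomial.\<close>

definition monomial_extension ::
    "(rat \<Rightarrow> 'c::ab_group_add \<Rightarrow> 'c) \<Rightarrow> (('v \<Rightarrow> nat) \<Rightarrow> ('v \<times> nat \<Rightarrow>\<^sub>0 nat) \<Rightarrow> 'c) \<Rightarrow> 'v coha \<Rightarrow> 'c" where
  "monomial_extension sc h F =
     (\<Sum>\<gamma>\<in>Poly_Mapping.keys F. linear_extension sc (h \<gamma>) (Poly_Mapping.lookup F \<gamma>))"

lemma monomial_extension_superset:
  assumes "Modules.module sc" "finite S" "Poly_Mapping.keys F \<subseteq> S"
  shows "monomial_extension sc h F =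
           (\<Sum>\<gamma>\<in>S. linear_extension sc (h \<gamma>) (Poly_Mapping.lookup F \<gamma>))"
  unfolding monomial_extension_def using assms(2,3)
  by (intro sum.mono_neutral_left) (auto simp: in_keys_iff linear_extension_def)

lemma module_hom_monomial_extension:
  assumes "Modules.module sc"
  shows "Modules.module_hom coha_scale sc (monomial_extension sc h)"
proof -
  have "monomial_extension sc h (F + G) = monomial_extension sc h F + monomial_extension sc h G"
    for F G
  proof -
    let ?S = "Poly_Mapping.keys F \<union> Poly_Mapping.keys G"
    have "monomial_extension sc h H =
        (\<Sum>\<gamma>\<in>?S. linear_extension sc (h \<gamma>) (Poly_Mapping.lookup H \<gamma>))"
      if "Poly_Mapping.keys H \<subseteq> ?S" for H
      using that by (intro monomial_extension_superset[OF assms]) auto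
    from this[of F] this[of G] this[of "F + G"] show ?thesis
      by (simp add: keys_add lookup_add linear_extension_add[OF assms] sum.distrib)
  qed
  moreover have "monomial_extension sc h (coha_scale c F) = sc c (monomial_extension sc h F)" for c F
  proof -
    have "monomial_extension sc h (coha_scale c F) = (\<Sum>\<gamma>\<in>Poly_Mapping.keys F.
        linear_extension sc (h \<gamma>) (Poly_Mapping.lookup (coha_scale c F) \<gamma>))"
      by (rule monomial_extension_superset[OF assms]) (auto simp: in_keys_iff)
    also have "\<dots> = sc c (monomial_extension sc h F)"
      by (simp add: monomial_extension_def module.scale_sum_right[OF assms]
          linear_extension_scale[OF assms])
    finally show ?thesis .
  qed
  ultimately show ?thesis
    by (simp add: Modules.module_hom_def Modules.module_hom_axioms_def coha.module_axioms assms)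
qed

lemma monomial_extension_monomial:
  assumes "Modules.module sc"
  shows "monomial_extension sc h (Poly_Mapping.single \<gamma> (Poly_Mapping.single m c)) = sc c (h \<gamma> m)"
  using monomial_extension_superset[OF assms, of "{\<gamma>}" "Poly_Mapping.single \<gamma> (Poly_Mapping.single m c)" h]
  by (simp add: linear_extension_single[OF assms])

lemma module_hom_comp_monomial_extension:
  assumes "Modules.module_hom sc sc' f"
  shows "f (monomial_extension sc h F) = monomial_extension sc' (\<lambda>\<gamma> m. f (h \<gamma> m)) F"
  by (simp add: monomial_extension_def linear_extension_def module_hom.sum[OF assms]
      module_hom.scale[OF assms])

section \<open>Symmetrization\<close>

definition rename_monomial :: "('x \<Rightarrow> 'y) \<Rightarrow> ('x \<Rightarrow>\<^sub>0 nat) \<Rightarrow> ('y \<Rightarrow>\<^sub>0 nat)" where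
  "rename_monomial \<tau> m =
     (\<Sum>v\<in>Poly_Mapping.keys m. Poly_Mapping.single (\<tau> v) (Poly_Mapping.lookup m v))"

definition rename_poly :: "('x \<Rightarrow> 'y) \<Rightarrow> ('x, rat) mpoly \<Rightarrow> ('y, rat) mpoly" where
  "rename_poly \<tau> = linear_extension free_scale (\<lambda>m. Poly_Mapping.single (rename_monomial \<tau> m) 1)"

lemma rename_poly_eq:
  "rename_poly \<tau> p = (\<Sum>m\<in>Poly_Mapping.keys p.
     Poly_Mapping.single (rename_monomial \<tau> m) (Poly_Mapping.lookup p m))"
  by (simp add: rename_poly_def linear_extension_def)

lemma single_power:
  "Poly_Mapping.single (m :: 'x::comm_monoid_add) (1::'c::comm_semiring_1) ^ n =
     Poly_Mapping.single (\<Sum>i<n. m) 1"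
  by (induction n) (simp_all add: mult_single add.commute)

lemma single_prod:
  "(\<Prod>i\<in>I. Poly_Mapping.single (f i :: 'x::comm_monoid_add) (1::'c::comm_semiring_1)) =
     Poly_Mapping.single (\<Sum>i\<in>I. f i) 1"
  by (induction I rule: infinite_finite_induct) (simp_all add: mult_single)

lemma sum_single_const: "(\<Sum>i<n. Poly_Mapping.single v (Suc 0)) = Poly_Mapping.single v n"
  by (induction n) (simp_all flip: single_add)

text \<open>A substitution of variables by variables only moves monomials, so it is the linear extension
  of a map on monomials. This turns both the symmetry condition and the evaluation on subsets of the
  roots into statements about exponent vectors.\<close>

lemma poly_eval_rename: "poly_eval pconst (\<lambda>v. pvar (\<tau> v)) p = rename_poly \<tau> p"
  by (simp add: poly_eval_def rename_poly_eq pvar_def single_power sum_single_const single_prod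
      pconst_def mult_single rename_monomial_def)

lemma rename_monomial_superset:
  assumes "finite S" "Poly_Mapping.keys m \<subseteq> S"
  shows "rename_monomial \<tau> m = (\<Sum>v\<in>S. Poly_Mapping.single (\<tau> v) (Poly_Mapping.lookup m v))"
  unfolding rename_monomial_def using assms
  by (intro sum.mono_neutral_left) (auto simp: in_keys_iff)

lemma rename_monomial_add:
  "rename_monomial \<tau> (m + n) = rename_monomial \<tau> m + rename_monomial \<tau> n"
proof -
  let ?S = "Poly_Mapping.keys m \<union> Poly_Mapping.keys n"
  have "rename_monomial \<tau> k = (\<Sum>v\<in>?S. Poly_Mapping.single (\<tau> v) (Poly_Mapping.lookup k v))"
    if "Poly_Mapping.keys k \<subseteq> ?S" for k
    using that by (intro rename_monomial_superset) auto
  from this[of m] this[of n] this[of "m + n"] show ?thesis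
    by (simp add: keys_add lookup_add single_add sum.distrib)
qed

lemma rename_monomial_zero [simp]: "rename_monomial \<tau> 0 = 0"
  by (simp add: rename_monomial_def)

lemma rename_monomial_single [simp]:
  "rename_monomial \<tau> (Poly_Mapping.single v n) = Poly_Mapping.single (\<tau> v) n"
  by (simp add: rename_monomial_def)

lemma rename_monomial_sum:
  "rename_monomial \<tau> (\<Sum>i\<in>I. f i) = (\<Sum>i\<in>I. rename_monomial \<tau> (f i))"
  by (induction I rule: infinite_finite_induct) (simp_all add: rename_monomial_add)

lemma rename_monomial_comp:
  "rename_monomial \<tau> (rename_monomial \<tau>' m) = rename_monomial (\<tau> \<circ> \<tau>') m"
  by (simp add: rename_monomial_def[of \<tau>'] rename_monomial_sum)
     (simp add: rename_monomial_def[of "\<tau> \<circ> \<tau>'"])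

lemma rename_monomial_cong:
  "(\<And>v. v \<in> Poly_Mapping.keys m \<Longrightarrow> \<tau> v = \<tau>' v) \<Longrightarrow> rename_monomial \<tau> m = rename_monomial \<tau>' m"
  by (simp add: rename_monomial_def)

lemma rename_monomial_ident:
  "(\<And>v. v \<in> Poly_Mapping.keys m \<Longrightarrow> \<tau> v = v) \<Longrightarrow> rename_monomial \<tau> m = m"
  by (simp add: rename_monomial_def poly_mapping_sum_single)

lemma keys_rename_monomial:
  "Poly_Mapping.keys (rename_monomial \<tau> m) \<subseteq> \<tau> ` Poly_Mapping.keys m"
  unfolding rename_monomial_def by (rule order.trans[OF keys_sum]) auto

lemma module_hom_rename_poly: "module_hom free_scale free_scale (rename_poly \<tau>)"
  unfolding rename_poly_def by (rule module_hom_linear_extension[OF free.module_axioms])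

lemma rename_poly_single [simp]:
  "rename_poly \<tau> (Poly_Mapping.single m c) = Poly_Mapping.single (rename_monomial \<tau> m) c"
  by (simp add: rename_poly_def linear_extension_single[OF free.module_axioms])

definition chern_roots :: "'v set \<Rightarrow> ('v \<Rightarrow> nat) \<Rightarrow> ('v \<times> nat) set" where
  "chern_roots A \<gamma> = {(i, k). i \<in> A \<and> k \<in> {1..\<gamma> i}}"

definition symmetries :: "('v \<Rightarrow> nat) \<Rightarrow> ('v \<Rightarrow> nat \<Rightarrow> nat) set" where
  "symmetries \<gamma> = {\<sigma>. \<forall>i. \<sigma> i permutes {1..\<gamma> i}}"

definition permute_roots :: "('v \<Rightarrow> nat \<Rightarrow> nat) \<Rightarrow> 'v \<times> nat \<Rightarrow> 'v \<times> nat" where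
  "permute_roots \<sigma> = (\<lambda>(i, k). (i, \<sigma> i k))"

lemma coha_deg_eq:
  "coha_deg Q \<gamma> = {p \<in> polys_in (chern_roots (verts Q) \<gamma>).
     \<forall>\<sigma>\<in>symmetries \<gamma>. rename_poly (permute_roots \<sigma>) p = p}"
proof -
  have "poly_eval pconst (\<lambda>(i, k). pvar (i, \<sigma> i k)) p = rename_poly (permute_roots \<sigma>) p"
    for \<sigma> :: "'a \<Rightarrow> nat \<Rightarrow> nat" and p
    unfolding poly_eval_rename[symmetric] by (simp add: permute_roots_def case_prod_unfold)
  then show ?thesis
    by (simp add: coha_deg_def chern_roots_def symmetries_def)
qed

lemma finite_symmetries:
  assumes "finite {i. \<gamma> i \<noteq> 0}"
  shows "finite (symmetries \<gamma>)"
proof (rule finite_subset)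
  let ?S = "{i. \<gamma> i \<noteq> 0}"
  let ?T = "\<Union>i\<in>?S. {\<pi>. \<pi> permutes {1..\<gamma> i}}"
  show "finite {\<sigma>. \<forall>i. (i \<in> ?S \<longrightarrow> \<sigma> i \<in> ?T) \<and> (i \<notin> ?S \<longrightarrow> \<sigma> i = id)}"
    using assms by (intro finite_set_of_finite_funs) (auto intro!: finite_permutations)
  show "symmetries \<gamma> \<subseteq> {\<sigma>. \<forall>i. (i \<in> ?S \<longrightarrow> \<sigma> i \<in> ?T) \<and> (i \<notin> ?S \<longrightarrow> \<sigma> i = id)}"
  proof
    fix \<sigma> assume "\<sigma> \<in> symmetries \<gamma>"
    then have "\<sigma> i permutes {1..\<gamma> i}" for i by (simp add: symmetries_def)
    then show "\<sigma> \<in> {\<sigma>. \<forall>i. (i \<in> ?S \<longrightarrow> \<sigma> i \<in> ?T) \<and> (i \<notin> ?S \<longrightarrow> \<sigma> i = id)}"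
      by (smt (verit) UN_iff atLeastatMost_empty le_numeral_extra(3) mem_Collect_eq not_one_le_zero
          permutes_empty atLeastatMost_empty_iff)
  qed
qed

lemma card_symmetries_pos:
  assumes "finite {i. \<gamma> i \<noteq> 0}"
  shows "card (symmetries \<gamma>) > 0"
proof -
  have "(\<lambda>i. id) \<in> symmetries \<gamma>" by (simp add: symmetries_def permutes_id)
  then show ?thesis using finite_symmetries[OF assms] card_gt_0_iff by blast
qed

text \<open>The group at a vertex of dimension \<open>0\<close> is trivial, so a symmetry of the sum is glued from its
  part over \<open>A\<close> and its part over the complement.\<close>

lemma symmetries_disjoint_sum:
  assumes \<gamma>1: "\<And>i. i \<notin> A \<Longrightarrow> \<gamma>1 i = 0" and \<gamma>2: "\<And>i. i \<in> A \<Longrightarrow> \<gamma>2 i = 0"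
  shows "bij_betw (\<lambda>(\<sigma>, \<tau>) i. if i \<in> A then \<sigma> i else \<tau> i)
           (symmetries \<gamma>1 \<times> symmetries \<gamma>2) (symmetries (\<gamma>1 + \<gamma>2))"
proof (rule bij_betw_byWitness
    [where f' = "\<lambda>\<rho>. (\<lambda>i. if i \<in> A then \<rho> i else id, \<lambda>i. if i \<in> A then id else \<rho> i)"])
  have trivial: "\<sigma> i = id" if "\<sigma> \<in> symmetries \<gamma>" "\<gamma> i = 0" for \<sigma> \<gamma> i
    using that by (auto simp: symmetries_def dest!: spec[of _ i])
  have "(\<lambda>i. if i \<in> A then \<sigma> i else id) = \<sigma>" if "\<sigma> \<in> symmetries \<gamma>1" for \<sigma>
    using trivial[OF that] \<gamma>1 by fastforce
  moreover have "(\<lambda>i. if i \<in> A then id else \<tau> i) = \<tau>" if "\<tau> \<in> symmetries \<gamma>2" for \<tau>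
    using trivial[OF that] \<gamma>2 by fastforce
  ultimately show "\<forall>st\<in>symmetries \<gamma>1 \<times> symmetries \<gamma>2.
      (\<lambda>\<rho>. (\<lambda>i. if i \<in> A then \<rho> i else id, \<lambda>i. if i \<in> A then id else \<rho> i))
        ((\<lambda>(\<sigma>, \<tau>) i. if i \<in> A then \<sigma> i else \<tau> i) st) = st"
    by (auto cong: if_cong)
  have "\<rho> i permutes {1..\<gamma>1 i}" if "\<rho> \<in> symmetries (\<gamma>1 + \<gamma>2)" "i \<in> A" for \<rho> i
    using that spec[of "\<lambda>i. \<rho> i permutes {1..\<gamma>1 i + \<gamma>2 i}" i] \<gamma>2[of i] by (simp add: symmetries_def)
  moreover have "\<rho> i permutes {1..\<gamma>2 i}" if "\<rho> \<in> symmetries (\<gamma>1 + \<gamma>2)" "i \<notin> A" for \<rho> i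
    using that spec[of "\<lambda>i. \<rho> i permutes {1..\<gamma>1 i + \<gamma>2 i}" i] \<gamma>1[of i] by (simp add: symmetries_def)
  ultimately show "(\<lambda>\<rho>. (\<lambda>i. if i \<in> A then \<rho> i else id, \<lambda>i. if i \<in> A then id else \<rho> i)) `
      symmetries (\<gamma>1 + \<gamma>2) \<subseteq> symmetries \<gamma>1 \<times> symmetries \<gamma>2"
    by (auto simp add: symmetries_def[of \<gamma>1] symmetries_def[of \<gamma>2] permutes_id)
qed (auto simp: symmetries_def \<gamma>1 \<gamma>2 split: if_splits)

text \<open>The Reynolds operator of the product of symmetric groups, applied to a monomial.\<close>

definition symmetrized :: "('v \<Rightarrow> nat) \<Rightarrow> ('v \<times> nat \<Rightarrow>\<^sub>0 nat) \<Rightarrow> ('v \<times> nat, rat) mpoly" where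
  "symmetrized \<gamma> m = (\<Sum>\<sigma>\<in>symmetries \<gamma>. Poly_Mapping.single
     (rename_monomial (permute_roots \<sigma>) m) (1 / of_nat (card (symmetries \<gamma>))))"

text \<open>The group of the sum is the product of the two groups, each of which moves only its own
  variables; hence averaging a product in separate variables is the product of the averages. This
  is the reason why a symmetric polynomial decomposes along disjoint sets of vertices.\<close>

lemma symmetrized_disjoint_sum:
  assumes \<gamma>1: "\<And>i. i \<notin> A \<Longrightarrow> \<gamma>1 i = 0" and \<gamma>2: "\<And>i. i \<in> A \<Longrightarrow> \<gamma>2 i = 0"
    and m1: "\<And>v. v \<in> Poly_Mapping.keys m1 \<Longrightarrow> fst v \<in> A"
    and m2: "\<And>v. v \<in> Poly_Mapping.keys m2 \<Longrightarrow> fst v \<notin> A"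
  shows "symmetrized (\<gamma>1 + \<gamma>2) (m1 + m2) = symmetrized \<gamma>1 m1 * symmetrized \<gamma>2 m2"
proof -
  let ?j = "\<lambda>(\<sigma>, \<tau>) i. if i \<in> A then \<sigma> i else \<tau> i :: nat \<Rightarrow> nat"
  have bij: "bij_betw ?j (symmetries \<gamma>1 \<times> symmetries \<gamma>2) (symmetries (\<gamma>1 + \<gamma>2))"
    by (rule symmetries_disjoint_sum) (use \<gamma>1 \<gamma>2 in auto)
  have card: "card (symmetries (\<gamma>1 + \<gamma>2)) = card (symmetries \<gamma>1) * card (symmetries \<gamma>2)"
    using bij_betw_same_card[OF bij] by (simp add: card_cartesian_product)
  have act: "rename_monomial (permute_roots (\<lambda>i. if i \<in> A then \<sigma> i else \<tau> i)) (m1 + m2) =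
      rename_monomial (permute_roots \<sigma>) m1 + rename_monomial (permute_roots \<tau>) m2" for \<sigma> \<tau>
    unfolding rename_monomial_add
    by (intro arg_cong2[where f = "(+)"] rename_monomial_cong) (auto simp: permute_roots_def dest!: m1 m2)
  let ?c = "\<lambda>\<gamma>. 1 / rat_of_nat (card (symmetries \<gamma>))"
  have "symmetrized (\<gamma>1 + \<gamma>2) (m1 + m2) = (\<Sum>st\<in>symmetries \<gamma>1 \<times> symmetries \<gamma>2.
      Poly_Mapping.single (rename_monomial (permute_roots (?j st)) (m1 + m2)) (?c (\<gamma>1 + \<gamma>2)))"
    unfolding symmetrized_def by (rule sum.reindex_bij_betw[OF bij, symmetric])
  also have "\<dots> = (\<Sum>(\<sigma>, \<tau>)\<in>symmetries \<gamma>1 \<times> symmetries \<gamma>2.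
      Poly_Mapping.single (rename_monomial (permute_roots \<sigma>) m1) (?c \<gamma>1) *
      Poly_Mapping.single (rename_monomial (permute_roots \<tau>) m2) (?c \<gamma>2))"
    by (intro sum.cong refl) (auto simp: act card mult_single)
  also have "\<dots> = symmetrized \<gamma>1 m1 * symmetrized \<gamma>2 m2"
    by (simp add: symmetrized_def sum_product sum.cartesian_product)
  finally show ?thesis .
qed

section \<open>Families supported on a set of vertices\<close>

text \<open>Families without any symmetry condition. Working in this larger space makes monomials
  available as a spanning set, on which multilinear identities can be checked.\<close>

definition supported :: "'v set \<Rightarrow> 'v coha set" where
  "supported A = {F. \<forall>\<gamma>\<in>Poly_Mapping.keys F. (\<forall>i. i \<notin> A \<longrightarrow> \<gamma> i = 0) \<and>
     Poly_Mapping.lookup F \<gamma> \<in> polys_in (chern_roots A \<gamma>)}"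

definition monomials :: "'v set \<Rightarrow> 'v coha set" where
  "monomials A = {Poly_Mapping.single \<gamma> (Poly_Mapping.single m 1) | \<gamma> m.
     (\<forall>i. i \<notin> A \<longrightarrow> \<gamma> i = 0) \<and> Poly_Mapping.keys m \<subseteq> chern_roots A \<gamma>}"

lemma subspace_polys_in: "free.subspace (polys_in J :: ('x, rat) mpoly set)"
proof (rule free.subspaceI)
  fix p q :: "('x, rat) mpoly"
  assume "p \<in> polys_in J" "q \<in> polys_in J"
  then show "p + q \<in> polys_in J"
    using keys_add[of p q] by (auto simp: polys_in_def dest!: subsetD[of "Poly_Mapping.keys (p + q)"])
qed (auto simp: polys_in_def dest!: subsetD[OF keys_free_scale])

lemma polys_in_mult:
  fixes p q :: "('x, rat) mpoly"
  assumes "p \<in> polys_in J" "q \<in> polys_in K"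
  shows "p * q \<in> polys_in (J \<union> K)"
  unfolding polys_in_def
proof safe
  fix m v assume "m \<in> Poly_Mapping.keys (p * q)" and v: "v \<in> Poly_Mapping.keys m" "v \<notin> K"
  then obtain a b where ab: "m = a + b" "a \<in> Poly_Mapping.keys p" "b \<in> Poly_Mapping.keys q"
    using keys_mult[of p q] by blast
  then have "v \<in> Poly_Mapping.keys a \<union> Poly_Mapping.keys b"
    using v keys_add[of a b] by blast
  then show "v \<in> J" using ab v assms by (auto simp: polys_in_def)
qed

lemma polys_in_mono: "J \<subseteq> K \<Longrightarrow> polys_in J \<subseteq> polys_in K"
  by (auto simp: polys_in_def)

lemma subspace_supported: "coha.subspace (supported A)"
proof (rule coha.subspaceI)
  fix F G :: "'a coha"
  assume FG: "F \<in> supported A" "G \<in> supported A"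
  then have "Poly_Mapping.lookup F \<gamma> \<in> polys_in (chern_roots A \<gamma>)"
    "Poly_Mapping.lookup G \<gamma> \<in> polys_in (chern_roots A \<gamma>)" for \<gamma>
    using free.subspace_0[OF subspace_polys_in] by (cases "\<gamma> \<in> Poly_Mapping.keys F"; 
      cases "\<gamma> \<in> Poly_Mapping.keys G"; force simp: supported_def in_keys_iff)+
  then show "F + G \<in> supported A"
    using FG keys_add[of F G] by (auto simp: supported_def lookup_add
        intro!: free.subspace_add[OF subspace_polys_in])
next
  fix c and F :: "'a coha"
  assume "F \<in> supported A"
  then show "coha_scale c F \<in> supported A"
    using keys_coha_scale[of c F]
    by (auto simp: supported_def intro!: free.subspace_scale[OF subspace_polys_in])
qed (auto simp: supported_def)

lemma single_in_supported:
  "(\<And>i. i \<notin> A \<Longrightarrow> \<gamma> i = 0) \<Longrightarrow> p \<in> polys_in (chern_roots A \<gamma>) \<Longrightarrow>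
     Poly_Mapping.single \<gamma> p \<in> supported A"
  by (auto simp: supported_def split: if_splits)

lemma monomials_subset_supported: "monomials A \<subseteq> supported A"
  by (auto simp: monomials_def polys_in_def intro!: single_in_supported)

lemma supported_mult:
  assumes "F \<in> supported A" "G \<in> supported B"
  shows "F * G \<in> supported (A \<union> B)"
proof -
  have "F * G = (\<Sum>\<gamma>1\<in>Poly_Mapping.keys F. Poly_Mapping.single \<gamma>1 (Poly_Mapping.lookup F \<gamma>1)) *
      (\<Sum>\<gamma>2\<in>Poly_Mapping.keys G. Poly_Mapping.single \<gamma>2 (Poly_Mapping.lookup G \<gamma>2))"
    by (simp add: poly_mapping_sum_single)
  also have "\<dots> \<in> supported (A \<union> B)"
    unfolding sum_product mult_single
  proof (intro coha.subspace_sum[OF subspace_supported] single_in_supported)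
    fix \<gamma>1 \<gamma>2 assume \<gamma>: "\<gamma>1 \<in> Poly_Mapping.keys F" "\<gamma>2 \<in> Poly_Mapping.keys G"
    then show "(\<gamma>1 + \<gamma>2) i = 0" if "i \<notin> A \<union> B" for i
      using that assms by (auto simp: supported_def)
    have "Poly_Mapping.lookup F \<gamma>1 * Poly_Mapping.lookup G \<gamma>2 \<in>
        polys_in (chern_roots A \<gamma>1 \<union> chern_roots B \<gamma>2)"
      using \<gamma> assms by (intro polys_in_mult) (auto simp: supported_def)
    then show "Poly_Mapping.lookup F \<gamma>1 * Poly_Mapping.lookup G \<gamma>2 \<in>
        polys_in (chern_roots (A \<union> B) (\<gamma>1 + \<gamma>2))"
      by (rule subsetD[OF polys_in_mono, rotated]) (auto simp: chern_roots_def)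
  qed
  finally show ?thesis .
qed

lemma supported_induct [consumes 1, case_names add scale monomial]:
  assumes "F \<in> supported A"
    and add: "\<And>G H. G \<in> supported A \<Longrightarrow> H \<in> supported A \<Longrightarrow> P G \<Longrightarrow> P H \<Longrightarrow> P (G + H)"
    and scale: "\<And>c G. G \<in> supported A \<Longrightarrow> P G \<Longrightarrow> P (coha_scale c G)"
    and monomial: "\<And>G. G \<in> monomials A \<Longrightarrow> P G"
  shows "P F"
proof -
  note mono = monomials_subset_supported[of A]
  let ?U = "{G \<in> supported A. P G}"
  \<comment> \<open>The zero family arises by scaling some monomial by \<open>0\<close>.\<close>
  have "Poly_Mapping.single 0 (Poly_Mapping.single 0 1) \<in> monomials A"
    unfolding monomials_def by (intro CollectI exI[of _ 0]) simp
  then have zero: "P 0"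
    using scale[of _ 0] mono monomial by fastforce
  have sub: "coha.subspace ?U"
    using subspace_supported[of A] by (auto simp: coha.subspace_def add scale zero)
  have "F = (\<Sum>\<gamma>\<in>Poly_Mapping.keys F. \<Sum>m\<in>Poly_Mapping.keys (Poly_Mapping.lookup F \<gamma>).
      coha_scale (Poly_Mapping.lookup (Poly_Mapping.lookup F \<gamma>) m)
        (Poly_Mapping.single \<gamma> (Poly_Mapping.single m 1)))"
    by (simp add: coha_scale_single poly_mapping_sum_single flip: single_sum)
  also have "\<dots> \<in> ?U"
  proof (intro coha.subspace_sum[OF sub] coha.subspace_scale[OF sub])
    fix \<gamma> m assume "\<gamma> \<in> Poly_Mapping.keys F" "m \<in> Poly_Mapping.keys (Poly_Mapping.lookup F \<gamma>)"
    then have "Poly_Mapping.single \<gamma> (Poly_Mapping.single m 1) \<in> monomials A"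
      using assms(1) unfolding supported_def polys_in_def monomials_def
      by (intro CollectI exI[of _ \<gamma>] exI[of _ m]) auto
    then show "Poly_Mapping.single \<gamma> (Poly_Mapping.single m 1) \<in> ?U"
      using mono monomial by auto
  qed
  finally show ?thesis by simp
qed

section \<open>Projection onto the symmetric part\<close>

lemma subspace_coha_deg: "free.subspace (coha_deg Q \<gamma>)"
  using subspace_polys_in[of "chern_roots (verts Q) \<gamma>"]
  by (auto simp: coha_deg_eq free.subspace_def module_hom.add[OF module_hom_rename_poly]
      module_hom.scale[OF module_hom_rename_poly] module_hom.zero[OF module_hom_rename_poly])

lemma subspace_coha: "coha.subspace (coha Q)"
proof (rule coha.subspaceI)
  fix F G assume "F \<in> coha Q" "G \<in> coha Q"
  then show "F + G \<in> coha Q"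
    using keys_add[of F G] by (auto simp: coha_def lookup_add intro!: free.subspace_add[OF subspace_coha_deg])
next
  fix c F assume "F \<in> coha Q"
  then show "coha_scale c F \<in> coha Q"
    using keys_coha_scale[of c F]
    by (auto simp: coha_def intro!: free.subspace_scale[OF subspace_coha_deg])
qed (auto simp: coha_def intro!: free.subspace_0[OF subspace_coha_deg])

lemma coha_subset_supported: "coha Q \<subseteq> supported (verts Q)"
  by (force simp: coha_def supported_def dimvecs_def coha_deg_eq)

lemma coha_component_eq:
  "\<gamma> \<in> dimvecs Q \<Longrightarrow> coha_component Q \<gamma> = {F \<in> coha Q. Poly_Mapping.keys F \<subseteq> {\<gamma>}}"
proof safe
  fix F assume \<gamma>: "\<gamma> \<in> dimvecs Q" and "F \<in> coha_component Q \<gamma>"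
  then obtain p where F: "F = Poly_Mapping.single \<gamma> p" "p \<in> coha_deg Q \<gamma>"
    by (auto simp: coha_component_def)
  then show "F \<in> coha Q"
    using \<gamma> free.subspace_0[OF subspace_coha_deg]
    by (auto simp: coha_def lookup_single when_def split: if_splits)
  show "\<gamma>' = \<gamma>" if "\<gamma>' \<in> Poly_Mapping.keys F" for \<gamma>'
    using that F by (simp split: if_splits)
next
  fix F assume *: "\<gamma> \<in> dimvecs Q" "F \<in> coha Q" "Poly_Mapping.keys F \<subseteq> {\<gamma>}"
  then have "F = Poly_Mapping.single \<gamma> (Poly_Mapping.lookup F \<gamma>)"
    using poly_mapping_sum_single[of F] by (cases "Poly_Mapping.keys F = {}") (auto simp: subset_singleton_iff)
  with * show "F \<in> coha_component Q \<gamma>" by (auto simp: coha_component_def coha_def)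
qed

definition symmetric_monomial :: "('v \<Rightarrow> nat) \<Rightarrow> ('v \<times> nat \<Rightarrow>\<^sub>0 nat) \<Rightarrow> 'v coha" where
  "symmetric_monomial \<gamma> m = Poly_Mapping.single \<gamma> (symmetrized \<gamma> m)"

lemma symmetries_comp:
  assumes "\<sigma> \<in> symmetries \<gamma>"
  shows "bij_betw (\<lambda>\<tau> i. \<sigma> i \<circ> \<tau> i) (symmetries \<gamma>) (symmetries \<gamma>)"
proof (rule bij_betw_byWitness[where f' = "\<lambda>\<tau> i. inv_into UNIV (\<sigma> i) \<circ> \<tau> i"])
  have \<sigma>: "\<sigma> i permutes {1..\<gamma> i}" for i using assms by (simp add: symmetries_def)
  show "\<forall>\<tau>\<in>symmetries \<gamma>. (\<lambda>i. inv_into UNIV (\<sigma> i) \<circ> (\<sigma> i \<circ> \<tau> i)) = \<tau>"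
    "\<forall>\<tau>\<in>symmetries \<gamma>. (\<lambda>i. \<sigma> i \<circ> (inv_into UNIV (\<sigma> i) \<circ> \<tau> i)) = \<tau>"
    using permutes_inv_o[OF \<sigma>] by (simp_all flip: comp_assoc)
  show "(\<lambda>\<tau> i. \<sigma> i \<circ> \<tau> i) ` symmetries \<gamma> \<subseteq> symmetries \<gamma>"
    "(\<lambda>\<tau> i. inv_into UNIV (\<sigma> i) \<circ> \<tau> i) ` symmetries \<gamma> \<subseteq> symmetries \<gamma>"
    using \<sigma> by (auto simp: symmetries_def intro!: permutes_compose permutes_inv)
qed

lemma rename_symmetrized:
  assumes "\<sigma> \<in> symmetries \<gamma>"
  shows "rename_poly (permute_roots \<sigma>) (symmetrized \<gamma> m) = symmetrized \<gamma> m"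
proof -
  let ?c = "1 / rat_of_nat (card (symmetries \<gamma>))"
  have comp: "permute_roots \<sigma> \<circ> permute_roots \<tau> = permute_roots (\<lambda>i. \<sigma> i \<circ> \<tau> i)" for \<tau>
    by (auto simp: permute_roots_def)
  have "rename_poly (permute_roots \<sigma>) (symmetrized \<gamma> m) = (\<Sum>\<tau>\<in>symmetries \<gamma>.
      Poly_Mapping.single (rename_monomial (permute_roots (\<lambda>i. \<sigma> i \<circ> \<tau> i)) m) ?c)"
    by (simp add: symmetrized_def module_hom.sum[OF module_hom_rename_poly] rename_monomial_comp comp)
  also have "\<dots> = symmetrized \<gamma> m"
    unfolding symmetrized_def by (rule sum.reindex_bij_betw[OF symmetries_comp[OF assms],
          where g = "\<lambda>\<tau>. Poly_Mapping.single (rename_monomial (permute_roots \<tau>) m) ?c"])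
  finally show ?thesis .
qed

lemma symmetric_monomial_in_coha_component:
  assumes "Poly_Mapping.keys m \<subseteq> chern_roots (verts Q) \<gamma>"
  shows "symmetric_monomial \<gamma> m \<in> coha_component Q \<gamma>"
proof -
  have "permute_roots \<sigma> ` chern_roots (verts Q) \<gamma> \<subseteq> chern_roots (verts Q) \<gamma>"
    if "\<sigma> \<in> symmetries \<gamma>" for \<sigma>
    using that permutes_in_image[of "\<sigma> _" "{1.._}"]
    by (fastforce simp: permute_roots_def chern_roots_def symmetries_def)
  then have "Poly_Mapping.keys (rename_monomial (permute_roots \<sigma>) m) \<subseteq> chern_roots (verts Q) \<gamma>"
    if "\<sigma> \<in> symmetries \<gamma>" for \<sigma>
    using that assms keys_rename_monomial[of "permute_roots \<sigma>" m] by blast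
  then have "symmetrized \<gamma> m \<in> polys_in (chern_roots (verts Q) \<gamma>)"
    unfolding symmetrized_def
    by (intro free.subspace_sum[OF subspace_polys_in]) (auto simp: polys_in_def split: if_splits)
  then show ?thesis
    by (auto simp: symmetric_monomial_def coha_component_def coha_deg_eq rename_symmetrized)
qed

definition symmetric_part :: "'v coha \<Rightarrow> 'v coha" where
  "symmetric_part = monomial_extension coha_scale symmetric_monomial"

lemma module_hom_symmetric_part: "module_hom coha_scale coha_scale symmetric_part"
  unfolding symmetric_part_def by (rule module_hom_monomial_extension[OF coha.module_axioms])

lemma symmetric_part_in_coha:
  assumes "F \<in> supported (verts Q)"
  shows "symmetric_part F \<in> coha Q"
  unfolding symmetric_part_def monomial_extension_def linear_extension_def
proof (intro coha.subspace_sum[OF subspace_coha] coha.subspace_scale[OF subspace_coha])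
  fix \<gamma> m assume "\<gamma> \<in> Poly_Mapping.keys F" "m \<in> Poly_Mapping.keys (Poly_Mapping.lookup F \<gamma>)"
  then have "\<gamma> \<in> dimvecs Q" "Poly_Mapping.keys m \<subseteq> chern_roots (verts Q) \<gamma>"
    using assms by (auto simp: supported_def polys_in_def dimvecs_def)
  then show "symmetric_monomial \<gamma> m \<in> coha Q"
    using symmetric_monomial_in_coha_component coha_component_eq by blast
qed

text \<open>The Reynolds operator fixes the invariants: summing the averages of all terms of a symmetric
  polynomial is averaging the polynomial itself.\<close>

lemma symmetric_part_of_coha:
  assumes "F \<in> coha Q" "finite (verts Q)"
  shows "symmetric_part F = F"
proof -
  have "(\<Sum>m\<in>Poly_Mapping.keys (Poly_Mapping.lookup F \<gamma>).
      free_scale (Poly_Mapping.lookup (Poly_Mapping.lookup F \<gamma>) m) (symmetrized \<gamma> m)) =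
      Poly_Mapping.lookup F \<gamma>" (is "?lhs = ?p") if "\<gamma> \<in> Poly_Mapping.keys F" for \<gamma>
  proof -
    let ?c = "1 / rat_of_nat (card (symmetries \<gamma>))"
    from that assms have \<gamma>: "\<gamma> \<in> dimvecs Q" and p: "?p \<in> coha_deg Q \<gamma>" by (auto simp: coha_def)
    from \<gamma> have "finite {i. \<gamma> i \<noteq> 0}"
      by (intro finite_subset[OF _ assms(2)]) (auto simp: dimvecs_def)
    then have card: "card (symmetries \<gamma>) > 0" by (rule card_symmetries_pos)
    have "?lhs = (\<Sum>m\<in>Poly_Mapping.keys ?p. \<Sum>\<sigma>\<in>symmetries \<gamma>. Poly_Mapping.single
        (rename_monomial (permute_roots \<sigma>) m) (Poly_Mapping.lookup ?p m * ?c))"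
      by (simp add: symmetrized_def free.scale_sum_right)
    also have "\<dots> = (\<Sum>\<sigma>\<in>symmetries \<gamma>. \<Sum>m\<in>Poly_Mapping.keys ?p. Poly_Mapping.single
        (rename_monomial (permute_roots \<sigma>) m) (Poly_Mapping.lookup ?p m * ?c))"
      by (rule sum.swap)
    also have "\<dots> = (\<Sum>\<sigma>\<in>symmetries \<gamma>. free_scale ?c (rename_poly (permute_roots \<sigma>) ?p))"
      by (simp add: rename_poly_eq free.scale_sum_right mult.commute)
    also have "\<dots> = (\<Sum>\<sigma>\<in>symmetries \<gamma>. free_scale ?c ?p)"
      using p by (simp add: coha_deg_eq)
    also have "\<dots> = free_scale (\<Sum>\<sigma>\<in>symmetries \<gamma>. ?c) ?p"
      by (rule free.scale_sum_left[symmetric])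
    also have "\<dots> = ?p"
      using card by simp
    finally show ?thesis .
  qed
  then show ?thesis
    by (simp add: symmetric_part_def symmetric_monomial_def monomial_extension_def linear_extension_def
        coha_scale_single poly_mapping_sum_single flip: single_sum)
qed

section \<open>The shuffle product across disjoint sets of vertices\<close>

lemma rename_poly_ident:
  assumes "p \<in> polys_in J" "\<And>v. v \<in> J \<Longrightarrow> \<tau> v = v"
  shows "rename_poly \<tau> p = p"
proof -
  have "rename_poly \<tau> p =
      (\<Sum>m\<in>Poly_Mapping.keys p. Poly_Mapping.single m (Poly_Mapping.lookup p m))"
    unfolding rename_poly_eq using assms
    by (intro sum.cong refl arg_cong2[where f = Poly_Mapping.single] rename_monomial_ident)
      (auto simp: polys_in_def)
  then show ?thesis by (simp add: poly_mapping_sum_single)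
qed

lemma eval_on_initial:
  assumes "p \<in> polys_in (chern_roots A \<gamma>)" "\<And>i. i \<in> A \<Longrightarrow> S i = {1..\<gamma> i}"
  shows "eval_on S p = p"
proof -
  have "sorted_list_of_set {1..n} ! (k - 1) = k" if "k \<in> {1..n}" for k n
  proof -
    have "{1..n} = {1..<Suc n}" by auto
    then show ?thesis using that by (simp del: upt_Suc)
  qed
  moreover have "eval_on S p = rename_poly (\<lambda>v. (fst v, sorted_list_of_set (S (fst v)) ! (snd v - 1))) p"
    unfolding poly_eval_rename[symmetric] by (simp add: eval_on_def case_prod_unfold)
  ultimately show ?thesis
    using rename_poly_ident[OF assms(1)] assms(2) by (auto simp: chern_roots_def)
qed

text \<open>At each vertex one of the two dimensions is \<open>0\<close>, so the shuffle sum has a single summand. Every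
  factor of its denominator is an empty product, and a nontrivial factor of its numerator can only come from an arrow with
  tail in the first set of vertices and head in the second.\<close>

lemma coha_shuffle_disjoint:
  assumes "wf_digraph Q" and A: "A \<subseteq> verts Q" and B: "B \<subseteq> verts Q" and AB: "A \<inter> B = {}"
    and arcs: "\<And>a. a \<in> arcs Q \<Longrightarrow> tail Q a \<in> A \<Longrightarrow> head Q a \<notin> B"
    and \<gamma>1: "\<And>i. i \<notin> A \<Longrightarrow> \<gamma>1 i = 0" and \<gamma>2: "\<And>i. i \<notin> B \<Longrightarrow> \<gamma>2 i = 0"
    and f1: "f1 \<in> polys_in (chern_roots A \<gamma>1)" and f2: "f2 \<in> polys_in (chern_roots B \<gamma>2)"
  shows "coha_shuffle Q \<gamma>1 \<gamma>2 f1 f2 = f1 * f2"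
proof -
  define S where "S = (\<lambda>i\<in>verts Q. {1..\<gamma>1 i})"
  define S' where "S' = (\<lambda>i. {1..\<gamma>1 i + \<gamma>2 i} - S i)"
  have "{T. T \<subseteq> {1..\<gamma>1 i + \<gamma>2 i} \<and> card T = \<gamma>1 i} = {{1..\<gamma>1 i}}" for i
  proof (cases "i \<in> A")
    case True
    then have "\<gamma>2 i = 0" using AB \<gamma>2 by blast
    then show ?thesis using card_subset_eq[of "{1..\<gamma>1 i}"] by auto
  next
    case False
    then show ?thesis using \<gamma>1 by (auto dest: finite_subset)
  qed
  then have "coha_subsets Q \<gamma>1 \<gamma>2 = (\<Pi>\<^sub>E i\<in>verts Q. {S i})"
    unfolding coha_subsets_def S_def by (intro PiE_cong) simp
  also have "\<dots> = {S}" by (rule PiE_singleton) (simp add: S_def extensional_def)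
  finally have subsets: "coha_subsets Q \<gamma>1 \<gamma>2 = {S}" .
  have S1: "S i = {1..\<gamma>1 i}" if "i \<in> verts Q" for i using that by (simp add: S_def)
  have S2: "S' i = {1..\<gamma>2 i}" if "i \<in> verts Q" for i
    using that \<gamma>1[of i] \<gamma>2[of i] AB by (cases "i \<in> A"; cases "i \<in> B") (auto simp: S'_def S_def)
  have num: "(\<Prod>a\<in>arcs Q. var_diff (head Q a) (S' (head Q a)) (tail Q a) (S (tail Q a))) = 1"
  proof (intro prod.neutral ballI)
    fix a assume a: "a \<in> arcs Q"
    then have "head Q a \<in> verts Q" "tail Q a \<in> verts Q"
      using assms(1) by (auto simp: wf_digraph_def)
    then have "S' (head Q a) = {} \<or> S (tail Q a) = {}"
      using arcs[OF a] \<gamma>1[of "tail Q a"] \<gamma>2[of "head Q a"]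
      by (cases "tail Q a \<in> A"; cases "head Q a \<in> B") (auto simp: S1 S2)
    then show "var_diff (head Q a) (S' (head Q a)) (tail Q a) (S (tail Q a)) = 1"
      by (auto simp: var_diff_def)
  qed
  have den: "(\<Prod>i\<in>verts Q. var_diff i (S' i) i (S i)) = 1"
  proof (intro prod.neutral ballI)
    fix i assume "i \<in> verts Q"
    then have "S' i = {} \<or> S i = {}"
      using AB \<gamma>1[of i] \<gamma>2[of i] by (cases "i \<in> A"; cases "i \<in> B") (auto simp: S1 S2)
    then show "var_diff i (S' i) i (S i) = 1" by (auto simp: var_diff_def)
  qed
  have ev: "eval_on S f1 = f1" "eval_on S' f2 = f2"
    using A B S1 S2 by (auto intro!: eval_on_initial[OF f1] eval_on_initial[OF f2])
  have "coha_shuffle Q \<gamma>1 \<gamma>2 f1 f2 =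
      (THE h. Fraction_Field.Fract h 1 = Fraction_Field.Fract (f1 * f2) 1)"
    using ev[unfolded S'_def] num[unfolded S'_def] den[unfolded S'_def]
    by (simp add: coha_shuffle_def subsets Let_def)
  then show ?thesis by (simp add: Fraction_Field.eq_fract)
qed

text \<open>The right-hand side is the convolution product of the two-level families. This turns
  the noncommutative multifactor product into a product in a commutative ring.\<close>

lemma coha_mult_disjoint:
  assumes "wf_digraph Q" "A \<subseteq> verts Q" "B \<subseteq> verts Q" "A \<inter> B = {}"
    and "\<And>a. a \<in> arcs Q \<Longrightarrow> tail Q a \<in> A \<Longrightarrow> head Q a \<notin> B"
    and F: "F \<in> supported A" and G: "G \<in> supported B"
  shows "coha_mult Q F G = F * G"
proof -
  have "coha_mult Q F G = (\<Sum>\<gamma>1\<in>Poly_Mapping.keys F. \<Sum>\<gamma>2\<in>Poly_Mapping.keys G.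
      Poly_Mapping.single (\<gamma>1 + \<gamma>2) (Poly_Mapping.lookup F \<gamma>1 * Poly_Mapping.lookup G \<gamma>2))"
    unfolding coha_mult_def using F G
    by (intro sum.cong refl arg_cong2[where f = Poly_Mapping.single] coha_shuffle_disjoint[OF assms(1-5)])
      (auto simp: supported_def)
  also have "\<dots> = (\<Sum>\<gamma>1\<in>Poly_Mapping.keys F. Poly_Mapping.single \<gamma>1 (Poly_Mapping.lookup F \<gamma>1)) *
      (\<Sum>\<gamma>2\<in>Poly_Mapping.keys G. Poly_Mapping.single \<gamma>2 (Poly_Mapping.lookup G \<gamma>2))"
    by (simp add: sum_product mult_single)
  also have "\<dots> = F * G" by (simp add: poly_mapping_sum_single)
  finally show ?thesis .
qed

lemma foldl_coha_mult_disjoint: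
  assumes wf: "wf_digraph Q"
  shows "f \<in> supported A \<Longrightarrow> list_all2 (\<lambda>g B. g \<in> supported B) gs Bs \<Longrightarrow>
     sorted_wrt (\<lambda>A B. A \<inter> B = {} \<and> (\<forall>a\<in>arcs Q. tail Q a \<in> A \<longrightarrow> head Q a \<notin> B)) (A # Bs) \<Longrightarrow>
     \<Union>(set (A # Bs)) \<subseteq> verts Q \<Longrightarrow> foldl (coha_mult Q) f gs = f * prod_list gs"
proof (induction gs arbitrary: f A Bs)
  case (Cons g gs)
  from Cons.prems(2) obtain B Bs' where Bs: "Bs = B # Bs'" and g: "g \<in> supported B"
    and gs: "list_all2 (\<lambda>g B. g \<in> supported B) gs Bs'"
    by (auto simp: list_all2_Cons1)
  have fg: "coha_mult Q f g = f * g"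
    using Cons.prems Bs g by (intro coha_mult_disjoint[OF wf, of A B]) auto
  have "foldl (coha_mult Q) (f * g) gs = (f * g) * prod_list gs"
    using Cons.prems Bs g gs by (intro Cons.IH[of _ "A \<union> B" Bs'] supported_mult) auto
  then show ?case by (simp add: fg mult.assoc)
qed simp

text \<open>The empty list agrees on both sides because the unit of the convolution ring is \<open>1\<close> in dimension
  vector \<open>0\<close>.\<close>

lemma coha_multifactor_disjoint:
  assumes "wf_digraph Q" "list_all2 (\<lambda>g B. g \<in> supported B) gs Bs"
    and "sorted_wrt (\<lambda>A B. A \<inter> B = {} \<and> (\<forall>a\<in>arcs Q. tail Q a \<in> A \<longrightarrow> head Q a \<notin> B)) Bs"
    and "\<Union>(set Bs) \<subseteq> verts Q"
  shows "coha_multifactor Q gs = prod_list gs"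
proof (cases gs)
  case (Cons f fs)
  then obtain A As where "Bs = A # As" "f \<in> supported A" "list_all2 (\<lambda>g B. g \<in> supported B) fs As"
    using assms(2) by (auto simp: list_all2_Cons1)
  with Cons assms show ?thesis using foldl_coha_mult_disjoint[of Q f A fs As] by auto
qed simp

section \<open>Splitting along disjoint blocks\<close>

definition restrict_dimvec :: "'v set \<Rightarrow> ('v \<Rightarrow> nat) \<Rightarrow> 'v \<Rightarrow> nat" where
  "restrict_dimvec A \<gamma> = (\<lambda>i. if i \<in> A then \<gamma> i else 0)"

definition restrict_monomial :: "'v set \<Rightarrow> ('v \<times> nat \<Rightarrow>\<^sub>0 nat) \<Rightarrow> ('v \<times> nat \<Rightarrow>\<^sub>0 nat)" where
  "restrict_monomial A m = Poly_Mapping.mapp (\<lambda>v n. if fst v \<in> A then n else 0) m"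

lemma lookup_restrict_monomial [simp]:
  "Poly_Mapping.lookup (restrict_monomial A m) v = (if fst v \<in> A then Poly_Mapping.lookup m v else 0)"
  by (simp add: restrict_monomial_def lookup_mapp when_def in_keys_iff)

lemma keys_restrict_monomial:
  "Poly_Mapping.keys (restrict_monomial A m) = {v \<in> Poly_Mapping.keys m. fst v \<in> A}"
  by (auto simp: in_keys_iff split: if_splits)

lemma restrict_dimvec_ident: "(\<And>i. i \<notin> A \<Longrightarrow> \<gamma> i = 0) \<Longrightarrow> restrict_dimvec A \<gamma> = \<gamma>"
  by (auto simp: restrict_dimvec_def)

lemma restrict_monomial_ident:
  "Poly_Mapping.keys m \<subseteq> chern_roots A \<gamma> \<Longrightarrow> restrict_monomial A m = m"
  by (rule poly_mapping_eqI) (auto simp: chern_roots_def in_keys_iff)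

lemma restrict_dimvec_Un:
  "A \<inter> B = {} \<Longrightarrow> restrict_dimvec (A \<union> B) \<gamma> = restrict_dimvec A \<gamma> + restrict_dimvec B \<gamma>"
  by (auto simp: restrict_dimvec_def fun_eq_iff)

lemma restrict_monomial_Un:
  "A \<inter> B = {} \<Longrightarrow>
     restrict_monomial (A \<union> B) m = restrict_monomial A m + restrict_monomial B m"
  by (rule poly_mapping_eqI) (auto simp: lookup_add)

lemma symmetric_monomial_Un:
  assumes "A \<inter> B = {}"
  shows "symmetric_monomial (restrict_dimvec (A \<union> B) \<gamma>) (restrict_monomial (A \<union> B) m) =
    symmetric_monomial (restrict_dimvec A \<gamma>) (restrict_monomial A m) *
    symmetric_monomial (restrict_dimvec B \<gamma>) (restrict_monomial B m)"
proof -
  have "symmetrized (restrict_dimvec A \<gamma> + restrict_dimvec B \<gamma>)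
      (restrict_monomial A m + restrict_monomial B m) =
    symmetrized (restrict_dimvec A \<gamma>) (restrict_monomial A m) *
    symmetrized (restrict_dimvec B \<gamma>) (restrict_monomial B m)"
    using assms by (intro symmetrized_disjoint_sum[of A])
      (auto simp: restrict_dimvec_def keys_restrict_monomial)
  then show ?thesis
    using assms by (simp add: symmetric_monomial_def mult_single restrict_dimvec_Un restrict_monomial_Un)
qed

lemma symmetric_monomial_empty:
  "symmetric_monomial (restrict_dimvec {} \<gamma>) (restrict_monomial {} m) = 1"
proof -
  have "symmetries (restrict_dimvec {} \<gamma>) = {\<lambda>i. id}"
    by (auto simp: symmetries_def restrict_dimvec_def)
  moreover have "restrict_monomial {} m = 0" "restrict_dimvec {} \<gamma> = 0"
    by (rule poly_mapping_eqI) (auto simp: restrict_dimvec_def)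
  ultimately show ?thesis by (simp add: symmetric_monomial_def symmetrized_def)
qed

text \<open>The factorization of a symmetrized monomial into symmetrized monomials, one for each block.\<close>

definition symmetric_tuple :: "'v set list \<Rightarrow> ('v \<Rightarrow> nat) \<Rightarrow> ('v \<times> nat \<Rightarrow>\<^sub>0 nat) \<Rightarrow> 'v coha list" where
  "symmetric_tuple As \<gamma> m =
     map (\<lambda>A. symmetric_monomial (restrict_dimvec A \<gamma>) (restrict_monomial A m)) As"

lemma prod_list_symmetric_tuple:
  "sorted_wrt (\<lambda>A B. A \<inter> B = {}) As \<Longrightarrow> prod_list (symmetric_tuple As \<gamma> m) =
     symmetric_monomial (restrict_dimvec (\<Union>(set As)) \<gamma>) (restrict_monomial (\<Union>(set As)) m)"
proof (induction As)
  case (Cons A As)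
  then have "A \<inter> \<Union>(set As) = {}" by auto
  with Cons show ?case by (simp add: symmetric_tuple_def symmetric_monomial_Un)
qed (simp add: symmetric_tuple_def symmetric_monomial_empty)

text \<open>A property that is preserved under linear combinations in each slot holds for all tuples as soon
  as it holds for tuples of monomials: the slots are replaced one after the other.\<close>

lemma multilinear_induct [consumes 1, case_names add scale monomial]:
  assumes "list_all2 (\<lambda>g A. g \<in> supported A) gs As"
    and add: "\<And>gs k u v. list_all2 (\<lambda>g A. g \<in> supported A) gs As \<Longrightarrow> k < length As \<Longrightarrow>
      u \<in> supported (As ! k) \<Longrightarrow> v \<in> supported (As ! k) \<Longrightarrow>
      P (gs[k := u]) \<Longrightarrow> P (gs[k := v]) \<Longrightarrow> P (gs[k := u + v])"
    and scale: "\<And>gs k c u. list_all2 (\<lambda>g A. g \<in> supported A) gs As \<Longrightarrow> k < length As \<Longrightarrow>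
      u \<in> supported (As ! k) \<Longrightarrow> P (gs[k := u]) \<Longrightarrow> P (gs[k := coha_scale c u])"
    and monomial: "\<And>gs. list_all2 (\<lambda>g A. g \<in> monomials A) gs As \<Longrightarrow> P gs"
  shows "P gs"
proof -
  have "P gs" if "k \<le> length As" "list_all2 (\<lambda>g A. g \<in> supported A) gs As"
    "\<And>j. k \<le> j \<Longrightarrow> j < length As \<Longrightarrow> gs ! j \<in> monomials (As ! j)" for k gs
    using that
  proof (induction k arbitrary: gs)
    case 0
    then show ?case by (intro monomial) (auto simp: list_all2_conv_all_nth)
  next
    case (Suc k)
    then have k: "k < length As" "gs ! k \<in> supported (As ! k)"
      by (auto simp: list_all2_conv_all_nth)
    from this(2) have "P (gs[k := gs ! k])"
    proof (induction rule: supported_induct)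
      case (monomial w)
      then have "w \<in> supported (As ! k)" using monomials_subset_supported by blast
      show ?case
      proof (rule Suc.IH)
        show "list_all2 (\<lambda>g A. g \<in> supported A) (gs[k := w]) As"
          using Suc.prems(2) \<open>w \<in> supported (As ! k)\<close> list_all2_update_cong[of _ gs As w "As ! k" k] by simp
        show "(gs[k := w]) ! j \<in> monomials (As ! j)" if "k \<le> j" "j < length As" for j
          using that monomial Suc.prems by (cases "j = k") (auto simp: list_all2_conv_all_nth)
      qed (use k in simp)
    qed (use add scale k Suc.prems in auto)
    then show ?case by simp
  qed
  from this[of "length As" gs] show ?thesis using assms(1) by simp
qed

text \<open>Each term of a family is sent to the tuple of symmetrized restrictions of its monomial. Modulo the
  tensor relations this inverts the multiplication map.\<close>

definition splitting :: "'v set list \<Rightarrow> 'v coha \<Rightarrow> ('v coha list \<Rightarrow>\<^sub>0 rat)" where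
  "splitting As = monomial_extension free_scale (\<lambda>\<gamma> m. Poly_Mapping.single (symmetric_tuple As \<gamma> m) 1)"

lemma module_hom_splitting: "module_hom coha_scale free_scale (splitting As)"
  unfolding splitting_def by (rule module_hom_monomial_extension[OF free.module_axioms])

lemma prod_list_monomials:
  "prod_list (map (\<lambda>j. Poly_Mapping.single (g j) (Poly_Mapping.single (m j) 1)) [0..<n]) =
     (Poly_Mapping.single (\<Sum>j<n. g j) (Poly_Mapping.single (\<Sum>j<n. m j) 1) :: 'v coha)"
proof (induction n)
  case 0
  show ?case by (simp only: lessThan_0 sum.empty upt_0 list.map prod_list.Nil single_one)
next
  case (Suc n)
  then show ?case unfolding sum.lessThan_Suc by (simp only: upt_Suc_append[OF le0] map_append
      prod_list.append mult_single list.map prod_list.Cons prod_list.Nil mult_1 mult_1_right)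
qed

lemma sum_fun_apply: "(\<Sum>j\<in>J. (g j :: 'v \<Rightarrow> nat)) i = (\<Sum>j\<in>J. g j i)"
  by (induction J rule: infinite_finite_induct) simp_all

text \<open>The blocks being disjoint, the restriction of a product of monomials to a block recovers the factor
  belonging to that block.\<close>

lemma splitting_monomials:
  assumes disj: "sorted_wrt (\<lambda>A B. A \<inter> B = {}) As"
    and gs: "list_all2 (\<lambda>g A. g \<in> monomials A) gs As"
  shows "splitting As (prod_list gs) = Poly_Mapping.single (map symmetric_part gs) 1"
proof -
  let ?n = "length As"
  have "\<forall>j<?n. \<exists>\<gamma> m. gs ! j = Poly_Mapping.single \<gamma> (Poly_Mapping.single m 1) \<and>
      (\<forall>i. i \<notin> As ! j \<longrightarrow> \<gamma> i = 0) \<and> Poly_Mapping.keys m \<subseteq> chern_roots (As ! j) \<gamma>"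
    using gs by (auto simp: list_all2_conv_all_nth monomials_def)
  then obtain g m where gm:
    "\<And>j. j < ?n \<Longrightarrow> gs ! j = Poly_Mapping.single (g j) (Poly_Mapping.single (m j) 1)"
    "\<And>j i. j < ?n \<Longrightarrow> i \<notin> As ! j \<Longrightarrow> g j i = 0"
    "\<And>j. j < ?n \<Longrightarrow> Poly_Mapping.keys (m j) \<subseteq> chern_roots (As ! j) (g j)"
    by metis
  have len: "length gs = ?n" using gs by (rule list_all2_lengthD)
  have gs_eq: "gs = map (\<lambda>j. Poly_Mapping.single (g j) (Poly_Mapping.single (m j) 1)) [0..<?n]"
    using len gm(1) by (intro nth_equalityI) auto
  have other: "i \<notin> As ! j" if "i \<in> As ! k" "j < ?n" "k < ?n" "j \<noteq> k" for i j k
    using disj that by (auto simp: sorted_wrt_iff_nth_less linorder_neq_iff)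
  have "restrict_dimvec (As ! k) (\<Sum>j<?n. g j) = g k" if k: "k < ?n" for k
  proof
    fix i
    have "(\<Sum>j<?n. g j i) = g k i" if "i \<in> As ! k"
      using k gm(2) other[OF that] by (subst sum.remove[of _ k]) (auto intro!: sum.neutral)
    then show "restrict_dimvec (As ! k) (\<Sum>j<?n. g j) i = g k i"
      using gm(2)[OF k] by (auto simp: restrict_dimvec_def sum_fun_apply)
  qed
  moreover have "restrict_monomial (As ! k) (\<Sum>j<?n. m j) = m k" if k: "k < ?n" for k
  proof (rule poly_mapping_eqI)
    fix v
    have zero: "Poly_Mapping.lookup (m j) v = 0" if "fst v \<notin> As ! j" "j < ?n" for j
      using that gm(3)[of j] by (auto simp: chern_roots_def in_keys_iff)
    have "(\<Sum>j<?n. Poly_Mapping.lookup (m j) v) = Poly_Mapping.lookup (m k) v" if "fst v \<in> As ! k"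
      using k zero other[OF that] by (subst sum.remove[of _ k]) (auto intro!: sum.neutral)
    then show "Poly_Mapping.lookup (restrict_monomial (As ! k) (\<Sum>j<?n. m j)) v =
        Poly_Mapping.lookup (m k) v"
      using zero[OF _ k] by (auto simp: lookup_sum)
  qed
  ultimately have "symmetric_tuple As (\<Sum>j<?n. g j) (\<Sum>j<?n. m j) = map symmetric_part gs"
    using len gm(1) by (intro nth_equalityI) (auto simp: symmetric_tuple_def symmetric_part_def
        monomial_extension_monomial[OF coha.module_axioms])
  then show ?thesis
    by (simp add: splitting_def gs_eq[THEN arg_cong, of prod_list] prod_list_monomials
        monomial_extension_monomial[OF free.module_axioms] del: free_scale_single)
qed

section \<open>The tensor product of the blocks\<close>

lemma listset_iff: "xs \<in> listset Vs \<longleftrightarrow> list_all2 (\<in>) xs Vs"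
  by (induction Vs arbitrary: xs) (auto simp: set_Cons_def list_all2_Cons2)

lemma subspace_free_space: "free.subspace (free_space B)"
proof (rule free.subspaceI)
  fix x y :: "'a \<Rightarrow>\<^sub>0 rat" assume "x \<in> free_space B" "y \<in> free_space B"
  then show "x + y \<in> free_space B" using keys_add[of x y] by (auto simp: free_space_def)
qed (auto simp: free_space_def dest!: subsetD[OF keys_free_scale])

lemma single_in_free_space: "k \<in> B \<Longrightarrow> Poly_Mapping.single k c \<in> free_space B"
  by (simp add: free_space_def)

lemma subspace_tensor_relations: "free.subspace (tensor_relations sc Vs)"
  unfolding tensor_relations_def by (rule free.subspace_span)

lemma tensor_relation_add:
  assumes "fs \<in> listset Vs" "k < length Vs" "u \<in> Vs ! k" "v \<in> Vs ! k"
  shows "Poly_Mapping.single (fs[k := u + v]) 1 - Poly_Mapping.single (fs[k := u]) 1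
     - Poly_Mapping.single (fs[k := v]) 1 \<in> tensor_relations sc Vs"
  unfolding tensor_relations_def using assms by (intro free.span_base UnI1) blast

lemma tensor_relation_scale:
  assumes "fs \<in> listset Vs" "k < length Vs" "u \<in> Vs ! k"
  shows "Poly_Mapping.single (fs[k := sc c u]) 1 - Poly_Mapping.single (fs[k := u]) c
     \<in> tensor_relations sc Vs"
  unfolding tensor_relations_def using assms by (intro free.span_base UnI2) blast

lemma tensor_class_eq_iff:
  "tensor_class sc Vs x = tensor_class sc Vs y \<longleftrightarrow> x - y \<in> tensor_relations sc Vs"
proof
  have "x \<in> tensor_class sc Vs x"
    using free.subspace_0[OF subspace_tensor_relations, of sc Vs] by (force simp: tensor_class_def)
  moreover assume "tensor_class sc Vs x = tensor_class sc Vs y"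
  ultimately have "x \<in> tensor_class sc Vs y" by simp
  then show "x - y \<in> tensor_relations sc Vs" by (auto simp: tensor_class_def)
next
  assume xy: "x - y \<in> tensor_relations sc Vs"
  have "x + r \<in> tensor_class sc Vs y" if "r \<in> tensor_relations sc Vs" for r
    using free.subspace_add[OF subspace_tensor_relations xy that]
    by (auto simp: tensor_class_def intro!: exI[of _ "x - y + r"])
  moreover have "y + r \<in> tensor_class sc Vs x" if "r \<in> tensor_relations sc Vs" for r
    using free.subspace_diff[OF subspace_tensor_relations that xy]
    by (auto simp: tensor_class_def intro!: exI[of _ "r - (x - y)"])
  ultimately show "tensor_class sc Vs x = tensor_class sc Vs y"
    by (auto simp: tensor_class_def[of _ _ x] tensor_class_def[of _ _ y])
qed

lemma tensor_plus_class:
  "tensor_plus (tensor_class sc Vs x) (tensor_class sc Vs y) = tensor_class sc Vs (x + y)"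
proof -
  have "x + r + (y + s) = x + y + (r + s)" "x + y + r = x + r + (y + 0)" for r s
    by (simp_all add: algebra_simps)
  then show ?thesis
    unfolding tensor_plus_def tensor_class_def
    using free.subspace_add[OF subspace_tensor_relations, of _ sc Vs]
      free.subspace_0[OF subspace_tensor_relations, of sc Vs] by blast
qed

lemma tensor_scale_class:
  "tensor_scale sc Vs c (tensor_class sc Vs x) = tensor_class sc Vs (free_scale c x)"
proof -
  have "free_scale c (x + r) + s = free_scale c x + (free_scale c r + s)"
    "free_scale c x + s = free_scale c (x + 0) + s" for r s
    by (simp_all add: free.scale_right_distrib add.assoc)
  then show ?thesis
    unfolding tensor_scale_def tensor_class_def
    using free.subspace_add[OF subspace_tensor_relations, of _ sc Vs]
      free.subspace_scale[OF subspace_tensor_relations, of _ sc Vs c]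
      free.subspace_0[OF subspace_tensor_relations, of sc Vs] by blast
qed

abbreviation coha_product :: "('v coha list \<Rightarrow>\<^sub>0 rat) \<Rightarrow> 'v coha" where
  "coha_product \<equiv> linear_extension coha_scale prod_list"

lemma module_hom_coha_product: "module_hom free_scale coha_scale coha_product"
  by (rule module_hom_linear_extension[OF coha.module_axioms])

lemma prod_list_update_add:
  fixes fs :: "'b::comm_ring_1 list"
  assumes "k < length fs"
  shows "prod_list (fs[k := u + v]) = prod_list (fs[k := u]) + prod_list (fs[k := v])"
  using assms by (simp add: upd_conv_take_nth_drop algebra_simps)

lemma prod_list_update_scale:
  assumes "k < length fs"
  shows "prod_list (fs[k := coha_scale c u]) = coha_scale c (prod_list (fs[k := u]))"
  using assms by (simp add: upd_conv_take_nth_drop coha_scale_mult)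

lemma coha_product_tensor_relations:
  fixes Vs :: "'v coha set list"
  assumes "r \<in> tensor_relations coha_scale Vs"
  shows "coha_product r = 0"
proof -
  interpret P: module_hom free_scale coha_scale "coha_product :: _ \<Rightarrow> 'v coha"
    by (rule module_hom_coha_product)
  have "length fs = length Vs" if "fs \<in> listset Vs" for fs
    using that by (simp add: listset_iff list_all2_lengthD)
  then have "tensor_relations coha_scale Vs \<subseteq> {r. coha_product r = 0}"
    unfolding tensor_relations_def
    by (intro free.span_minimal P.subspace_kernel)
      (auto simp: P.diff linear_extension_single[OF coha.module_axioms]
        prod_list_update_add prod_list_update_scale)
  then show ?thesis using assms by blast
qed

text \<open>The relations only involve tuples of elements of the factors, so a formula for the multifactor
  product that is valid on those tuples may be used throughout a coset.\<close>

lemma tensor_relations_subset_free_space: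
  assumes "\<And>V. V \<in> set Vs \<Longrightarrow> coha.subspace V"
  shows "tensor_relations coha_scale Vs \<subseteq> free_space (listset Vs)"
proof -
  have update: "fs[j := w] \<in> listset Vs" if "fs \<in> listset Vs" "j < length Vs" "w \<in> Vs ! j" for fs j w
    using list_all2_update_cong[of "(\<in>)" fs Vs w "Vs ! j" j] that by (simp add: listset_iff)
  have sub: "coha.subspace (Vs ! j)" if "j < length Vs" for j using assms that by simp
  show ?thesis
    unfolding tensor_relations_def
    by (intro free.span_minimal subspace_free_space)
      (auto intro!: free.subspace_diff[OF subspace_free_space] single_in_free_space update
        coha.subspace_add[OF sub] coha.subspace_scale[OF sub])
qed

lemma keys_prod_list_homogeneous:
  assumes "length \<gamma>s = length Rs" "fs \<in> listset (map2 coha_component Rs \<gamma>s)"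
  shows "Poly_Mapping.keys (prod_list fs) \<subseteq> {sum_list \<gamma>s}"
  using assms
proof (induction \<gamma>s Rs arbitrary: fs rule: list_induct2)
  case (Cons \<gamma> \<gamma>s R Rs)
  then obtain f fs' where fs: "fs = f # fs'" "f \<in> coha_component R \<gamma>"
    "fs' \<in> listset (map2 coha_component Rs \<gamma>s)"
    by (auto simp: set_Cons_def)
  from fs(2) have "Poly_Mapping.keys f \<subseteq> {\<gamma>}" by (auto simp: coha_component_def split: if_splits)
  then show ?case
    using Cons.IH[OF fs(3)] keys_mult[of f "prod_list fs'"]
    unfolding fs(1) prod_list.Cons sum_list.Cons by blast
qed simp

lemma prod_list_supported:
  assumes "list_all2 (\<lambda>g A. g \<in> supported A) gs As"
  shows "prod_list gs \<in> supported (\<Union>(set As))"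
  using assms
proof (induction rule: list_all2_induct)
  case Nil
  have "Poly_Mapping.single 0 1 \<in> supported {}"
    by (rule single_in_supported) (auto simp: polys_in_def)
  then show ?case by simp
next
  case (Cons g gs A As)
  then show ?case using supported_mult[of g A "prod_list gs" "\<Union>(set As)"] by simp
qed

lemma sum_list_restrict_dimvec:
  assumes "sorted_wrt (\<lambda>A B. A \<inter> B = {}) (map verts Rs)"
  shows "sum_list (map (\<lambda>R. restrict_dimvec (verts R) \<gamma>) Rs) =
     restrict_dimvec (\<Union>(set (map verts Rs))) \<gamma>"
  using assms
proof (induction Rs)
  case (Cons R Rs)
  then have "verts R \<inter> \<Union>(set (map verts Rs)) = {}" by auto
  then show ?case using Cons by (simp add: restrict_dimvec_Un)
qed (simp add: restrict_dimvec_def zero_fun_def)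

locale disjoint_blocks =
  fixes Rs :: "('v::linorder, 'a) pre_digraph list"
  assumes finite_verts: "\<And>R. R \<in> set Rs \<Longrightarrow> finite (verts R)"
    and disjoint: "sorted_wrt (\<lambda>A B. A \<inter> B = {}) (map verts Rs)"
begin

abbreviation relations :: "('v coha list \<Rightarrow>\<^sub>0 rat) set" where
  "relations \<equiv> tensor_relations coha_scale (map coha Rs)"

text \<open>Both sides are multilinear modulo the tensor relations, so it is enough to compare them on
  monomials, where they coincide.\<close>

lemma splitting_prod_list:
  assumes "list_all2 (\<lambda>g A. g \<in> supported A) gs (map verts Rs)"
  shows "splitting (map verts Rs) (prod_list gs) - Poly_Mapping.single (map symmetric_part gs) 1
    \<in> relations"
proof -
  let ?d = "\<lambda>gs. splitting (map verts Rs) (prod_list gs) -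
    Poly_Mapping.single (map symmetric_part gs) 1"
  note hom = module_hom.add[OF module_hom_splitting] module_hom.add[OF module_hom_symmetric_part]
    module_hom.scale[OF module_hom_splitting] module_hom.scale[OF module_hom_symmetric_part]
  have tuple: "map symmetric_part gs \<in> listset (map coha Rs)"
    if "list_all2 (\<lambda>g A. g \<in> supported A) gs (map verts Rs)" for gs
    using that by (auto simp: listset_iff list_all2_conv_all_nth intro!: symmetric_part_in_coha)
  show ?thesis
    using assms
  proof (induction rule: multilinear_induct)
    case (add gs k u v)
    \<comment> \<open>The defect of the sum is the sum of the defects up to this generating relation.\<close>
    let ?r = "Poly_Mapping.single ((map symmetric_part gs)[k := symmetric_part u + symmetric_part v]) 1
      - Poly_Mapping.single ((map symmetric_part gs)[k := symmetric_part u]) 1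
      - Poly_Mapping.single ((map symmetric_part gs)[k := symmetric_part v]) 1"
    have "?r \<in> relations"
      using add symmetric_part_in_coha by (intro tensor_relation_add tuple) auto
    then have "?d (gs[k := u]) + ?d (gs[k := v]) - ?r \<in> relations"
      by (rule free.subspace_diff[OF subspace_tensor_relations
            free.subspace_add[OF subspace_tensor_relations add(5,6)]])
    moreover have "?d (gs[k := u + v]) = ?d (gs[k := u]) + ?d (gs[k := v]) - ?r"
      using add(1,2) by (simp add: prod_list_update_add list_all2_lengthD map_update hom)
    ultimately show ?case by simp
  next
    case (scale gs k c u)
    let ?r = "Poly_Mapping.single ((map symmetric_part gs)[k := coha_scale c (symmetric_part u)]) 1
      - Poly_Mapping.single ((map symmetric_part gs)[k := symmetric_part u]) c"
    have "?r \<in> relations"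
      using scale symmetric_part_in_coha by (intro tensor_relation_scale tuple) auto
    then have "free_scale c (?d (gs[k := u])) - ?r \<in> relations"
      by (rule free.subspace_diff[OF subspace_tensor_relations
            free.subspace_scale[OF subspace_tensor_relations scale(4)]])
    moreover have "?d (gs[k := coha_scale c u]) = free_scale c (?d (gs[k := u])) - ?r"
      using scale(1,2) by (simp add: prod_list_update_scale list_all2_lengthD map_update hom
          free.scale_right_diff_distrib)
    ultimately show ?case by simp
  next
    case (monomial gs)
    then show ?case
      using splitting_monomials[OF disjoint monomial] free.subspace_0[OF subspace_tensor_relations]
      by simp
  qed
qed

lemma listset_coha_supported:
  assumes "fs \<in> listset (map coha Rs)"
  shows "list_all2 (\<lambda>g A. g \<in> supported A) fs (map verts Rs)"
  using assms coha_subset_supported by (fastforce simp: listset_iff list_all2_conv_all_nth)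

text \<open>Elements of the factors are fixed by the Reynolds operator, so splitting is a left inverse of
  multiplication; this gives injectivity.\<close>

lemma splitting_coha_product:
  assumes x: "x \<in> free_space (listset (map coha Rs))"
  shows "splitting (map verts Rs) (coha_product x) - x \<in> relations"
proof -
  have "splitting (map verts Rs) (coha_product x) - x = (\<Sum>fs\<in>Poly_Mapping.keys x.
      free_scale (Poly_Mapping.lookup x fs)
        (splitting (map verts Rs) (prod_list fs) - Poly_Mapping.single fs 1))"
    by (subst (2) poly_mapping_sum_single[of x, symmetric])
      (simp add: linear_extension_def module_hom.sum[OF module_hom_splitting]
        module_hom.scale[OF module_hom_splitting] free.scale_right_diff_distrib sum_subtractf)
  also have "\<dots> \<in> relations"
  proof (intro free.subspace_sum free.subspace_scale subspace_tensor_relations)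
    fix fs assume "fs \<in> Poly_Mapping.keys x"
    then have fs: "fs \<in> listset (map coha Rs)" using x by (auto simp: free_space_def)
    then have "map symmetric_part fs = fs"
      using finite_verts by (auto simp: listset_iff list_all2_conv_all_nth
          intro!: nth_equalityI symmetric_part_of_coha)
    then show "splitting (map verts Rs) (prod_list fs) - Poly_Mapping.single fs 1 \<in> relations"
      using splitting_prod_list[OF listset_coha_supported[OF fs]] by simp
  qed
  finally show ?thesis .
qed

text \<open>Splitting a term and multiplying back yields the average of its monomial. On symmetric families
  splitting is therefore a right inverse of multiplication; this gives surjectivity.\<close>

lemma coha_product_splitting:
  assumes "F \<in> supported (\<Union>(set (map verts Rs)))"
  shows "coha_product (splitting (map verts Rs) F) = symmetric_part F"
proof -
  let ?V = "\<Union>(set (map verts Rs))"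
  have "prod_list (symmetric_tuple (map verts Rs) \<gamma> m) = symmetric_monomial \<gamma> m"
    if "\<gamma> \<in> Poly_Mapping.keys F" "m \<in> Poly_Mapping.keys (Poly_Mapping.lookup F \<gamma>)" for \<gamma> m
  proof -
    have "restrict_dimvec ?V \<gamma> = \<gamma>"
      using that assms by (intro restrict_dimvec_ident) (auto simp: supported_def)
    moreover have "restrict_monomial ?V m = m"
      using that assms by (intro restrict_monomial_ident[of _ _ \<gamma>]) (auto simp: supported_def polys_in_def)
    ultimately show ?thesis using prod_list_symmetric_tuple[OF disjoint, of \<gamma> m] by simp
  qed
  then show ?thesis
    unfolding splitting_def module_hom_comp_monomial_extension[OF module_hom_coha_product]
      symmetric_part_def
    by (simp add: linear_extension_single[OF coha.module_axioms] monomial_extension_def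
        linear_extension_def)
qed

lemma symmetric_tuple_in_components:
  assumes "Poly_Mapping.keys m \<subseteq> chern_roots (\<Union>(set (map verts Rs))) \<gamma>"
  shows "symmetric_tuple (map verts Rs) \<gamma> m \<in>
    listset (map2 coha_component Rs (map (\<lambda>R. restrict_dimvec (verts R) \<gamma>) Rs))"
proof -
  have "symmetric_monomial (restrict_dimvec (verts R) \<gamma>) (restrict_monomial (verts R) m)
      \<in> coha_component R (restrict_dimvec (verts R) \<gamma>)" for R :: "('v, 'a) pre_digraph"
    using assms by (intro symmetric_monomial_in_coha_component)
      (force simp: keys_restrict_monomial chern_roots_def restrict_dimvec_def)
  then show ?thesis
    by (simp add: listset_iff list_all2_conv_all_nth symmetric_tuple_def)
qed

lemma splitting_single_in_free_space:
  assumes \<gamma>: "\<And>i. i \<notin> \<Union>(set (map verts Rs)) \<Longrightarrow> \<gamma> i = 0"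
    and p: "p \<in> polys_in (chern_roots (\<Union>(set (map verts Rs))) \<gamma>)"
  shows "splitting (map verts Rs) (Poly_Mapping.single \<gamma> p) \<in>
     free_space {fs. \<exists>\<gamma>s. length \<gamma>s = length Rs \<and> sum_list \<gamma>s = \<gamma> \<and>
       (\<forall>j < length Rs. \<gamma>s ! j \<in> dimvecs (Rs ! j)) \<and>
       fs \<in> listset (map2 coha_component Rs \<gamma>s)}" (is "_ \<in> free_space ?H")
proof -
  let ?\<gamma>s = "map (\<lambda>R. restrict_dimvec (verts R) \<gamma>) Rs"
  have sum: "sum_list ?\<gamma>s = \<gamma>"
    unfolding sum_list_restrict_dimvec[OF disjoint] by (rule restrict_dimvec_ident) (rule \<gamma>)
  have tuple: "symmetric_tuple (map verts Rs) \<gamma> m \<in> ?H" if "m \<in> Poly_Mapping.keys p" for m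
  proof -
    have "Poly_Mapping.keys m \<subseteq> chern_roots (\<Union>(set (map verts Rs))) \<gamma>"
      using that p by (auto simp: polys_in_def)
    from symmetric_tuple_in_components[OF this] sum show ?thesis
      by (intro CollectI exI[of _ ?\<gamma>s]) (simp add: dimvecs_def restrict_dimvec_def)
  qed
  have "splitting (map verts Rs) (Poly_Mapping.single \<gamma> p) =
      linear_extension free_scale
        (\<lambda>m. Poly_Mapping.single (symmetric_tuple (map verts Rs) \<gamma> m) 1) p"
    unfolding splitting_def
    by (subst monomial_extension_superset[OF free.module_axioms, of "{\<gamma>}"]) auto
  also have "\<dots> \<in> free_space ?H"
    unfolding linear_extension_def using tuple
    by (intro free.subspace_sum free.subspace_scale subspace_free_space single_in_free_space)
  finally show ?thesis .
qed

lemma homogeneous_in_listset: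
  assumes "\<forall>j < length Rs. \<gamma>s ! j \<in> dimvecs (Rs ! j)" "length \<gamma>s = length Rs"
    and "fs \<in> listset (map2 coha_component Rs \<gamma>s)"
  shows "fs \<in> listset (map coha Rs)"
  using assms coha_component_eq by (fastforce simp: listset_iff list_all2_conv_all_nth)

lemma splitting_in_free_space:
  assumes "F \<in> supported (\<Union>(set (map verts Rs)))"
  shows "splitting (map verts Rs) F \<in> free_space (listset (map coha Rs))"
proof -
  have "splitting (map verts Rs) F = (\<Sum>\<gamma>\<in>Poly_Mapping.keys F.
      splitting (map verts Rs) (Poly_Mapping.single \<gamma> (Poly_Mapping.lookup F \<gamma>)))"
    by (subst (1) poly_mapping_sum_single[of F, symmetric])
      (simp only: module_hom.sum[OF module_hom_splitting])
  also have "\<dots> \<in> free_space (listset (map coha Rs))"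
  proof (intro free.subspace_sum subspace_free_space)
    fix \<gamma> assume "\<gamma> \<in> Poly_Mapping.keys F"
    then have "splitting (map verts Rs) (Poly_Mapping.single \<gamma> (Poly_Mapping.lookup F \<gamma>)) \<in>
     free_space {fs. \<exists>\<gamma>s. length \<gamma>s = length Rs \<and> sum_list \<gamma>s = \<gamma> \<and>
       (\<forall>j < length Rs. \<gamma>s ! j \<in> dimvecs (Rs ! j)) \<and>
       fs \<in> listset (map2 coha_component Rs \<gamma>s)}"
      using assms by (intro splitting_single_in_free_space) (auto simp: supported_def)
    then show "splitting (map verts Rs) (Poly_Mapping.single \<gamma> (Poly_Mapping.lookup F \<gamma>)) \<in>
        free_space (listset (map coha Rs))"
      using homogeneous_in_listset unfolding free_space_def by blast
  qed
  finally show ?thesis .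
qed

lemma coha_product_supported:
  assumes "x \<in> free_space (listset (map coha Rs))"
  shows "coha_product x \<in> supported (\<Union>(set (map verts Rs)))"
  unfolding linear_extension_def
  using assms listset_coha_supported
  by (intro coha.subspace_sum coha.subspace_scale subspace_supported prod_list_supported)
    (auto simp: free_space_def)

section \<open>The multiplication map\<close>

text \<open>Once the multifactor product agrees with the convolution product, its value on a class of
  the tensor product does not depend on the representative.\<close>

lemma coha_mult_map_class:
  assumes mult: "\<And>fs. fs \<in> listset (map coha Rs) \<Longrightarrow> coha_multifactor Q fs = prod_list fs"
    and x: "x \<in> free_space (listset (map coha Rs))"
  shows "coha_mult_map Q (tensor_class coha_scale (map coha Rs) x) = coha_product x"
proof -
  have rel: "relations \<subseteq> free_space (listset (map coha Rs))"
    by (rule tensor_relations_subset_free_space) (auto simp: subspace_coha)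
  have "linear_extension coha_scale (coha_multifactor Q) (x + r) = coha_product x"
    if r: "r \<in> relations" for r
  proof -
    have "x + r \<in> free_space (listset (map coha Rs))"
      using free.subspace_add[OF subspace_free_space x] r rel by blast
    then have "linear_extension coha_scale (coha_multifactor Q) (x + r) = coha_product (x + r)"
      unfolding linear_extension_def
      by (intro sum.cong refl arg_cong[where f = "coha_scale _"] mult) (auto simp: free_space_def)
    then show ?thesis
      by (simp add: module_hom.add[OF module_hom_coha_product] coha_product_tensor_relations[OF r])
  qed
  moreover have "0 \<in> relations" by (rule free.subspace_0[OF subspace_tensor_relations])
  ultimately have "linear_extension coha_scale (coha_multifactor Q) `
      tensor_class coha_scale (map coha Rs) x = {coha_product x}"
    by (force simp: tensor_class_def)
  then show ?thesis by (simp add: coha_mult_map_def tensor_induced_def)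
qed

text \<open>Splitting and multiplying are inverse to each other up to tensor relations, and both preserve the
  dimension vector.\<close>

theorem coha_graded_iso_if_multifactor_eq_prod_list:
  assumes mult: "\<And>fs. fs \<in> listset (map coha Rs) \<Longrightarrow> coha_multifactor Q fs = prod_list fs"
    and verts: "\<Union>(set (map verts Rs)) = verts Q"
  shows "coha_graded_iso Q Rs (coha_mult_map Q)"
proof -
  let ?V = "listset (map coha Rs)"
  let ?cls = "tensor_class coha_scale (map coha Rs)"
  have finite: "finite (verts Q)" using finite_verts by (auto simp flip: verts)
  note \<Phi> = coha_mult_map_class[OF mult]
  have tensor: "coha_tensor Rs = ?cls ` free_space ?V"
    by (simp add: coha_tensor_def tensor_space_def)
  have supp: "F \<in> supported (\<Union>(set (map verts Rs)))" if "F \<in> coha Q" for F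
    unfolding verts using that coha_subset_supported by blast
  have section_product: "coha_product (splitting (map verts Rs) F) = F" if "F \<in> coha Q" for F
    using coha_product_splitting[OF supp[OF that]] symmetric_part_of_coha[OF that finite] by simp
  \<comment> \<open>Splitting a product changes the tensor only by relations, so the Reynolds operator fixes the
      product, which is therefore symmetric.\<close>
  have product_in: "coha_product x \<in> coha Q" if x: "x \<in> free_space ?V" for x
  proof -
    have "coha_product (splitting (map verts Rs) (coha_product x) - x) = 0"
      by (rule coha_product_tensor_relations[OF splitting_coha_product[OF x]])
    then have "coha_product x = symmetric_part (coha_product x)"
      using coha_product_splitting[OF coha_product_supported[OF x]]
      by (simp add: module_hom.diff[OF module_hom_coha_product])
    also have "\<dots> \<in> coha Q"
      using coha_product_supported[OF x] unfolding verts by (rule symmetric_part_in_coha)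
    finally show ?thesis .
  qed
  have splitting_in: "splitting (map verts Rs) F \<in> free_space ?V" if "F \<in> coha Q" for F
    by (rule splitting_in_free_space[OF supp[OF that]])
  have inj: "?cls x = ?cls y"
    if "x \<in> free_space ?V" "y \<in> free_space ?V" "coha_product x = coha_product y" for x y
  proof -
    have "x - y \<in> free_space ?V" using that by (intro free.subspace_diff subspace_free_space)
    then have "splitting (map verts Rs) (coha_product (x - y)) - (x - y) \<in> relations"
      by (rule splitting_coha_product)
    then have "- (x - y) \<in> relations"
      using that(3) by (simp add: module_hom.diff[OF module_hom_coha_product]
          module_hom.zero[OF module_hom_splitting])
    then have "x - y \<in> relations"
      using free.subspace_neg[OF subspace_tensor_relations] by fastforce
    then show ?thesis by (simp add: tensor_class_eq_iff)
  qed
  have bij: "bij_betw (coha_mult_map Q) (coha_tensor Rs) (coha Q)"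
    unfolding bij_betw_def
  proof
    show "inj_on (coha_mult_map Q) (coha_tensor Rs)"
      by (clarsimp simp: inj_on_def tensor \<Phi>) (rule inj)
    show "coha_mult_map Q ` coha_tensor Rs = coha Q"
    proof
      show "coha_mult_map Q ` coha_tensor Rs \<subseteq> coha Q" by (auto simp: tensor \<Phi> product_in)
      show "coha Q \<subseteq> coha_mult_map Q ` coha_tensor Rs"
      proof
        fix F assume F: "F \<in> coha Q"
        then have "F = coha_mult_map Q (?cls (splitting (map verts Rs) F))"
          by (simp add: \<Phi> splitting_in section_product)
        then show "F \<in> coha_mult_map Q ` coha_tensor Rs"
          using splitting_in[OF F] unfolding tensor by blast
      qed
    qed
  qed
  have graded: "coha_mult_map Q ` coha_tensor_component Rs \<gamma> = coha_component Q \<gamma>"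
    if \<gamma>: "\<gamma> \<in> dimvecs Q" for \<gamma>
  proof -
    define H where "H = {fs. \<exists>\<gamma>s. length \<gamma>s = length Rs \<and> sum_list \<gamma>s = \<gamma> \<and>
       (\<forall>j < length Rs. \<gamma>s ! j \<in> dimvecs (Rs ! j)) \<and> fs \<in> listset (map2 coha_component Rs \<gamma>s)}"
    have comp: "coha_tensor_component Rs \<gamma> = ?cls ` free_space H"
      by (simp add: coha_tensor_component_def H_def)
    have H: "fs \<in> ?V" "Poly_Mapping.keys (prod_list fs) \<subseteq> {\<gamma>}" if "fs \<in> H" for fs
    proof -
      from that obtain \<gamma>s where \<gamma>s: "length \<gamma>s = length Rs" "sum_list \<gamma>s = \<gamma>"
        "\<forall>j < length Rs. \<gamma>s ! j \<in> dimvecs (Rs ! j)" "fs \<in> listset (map2 coha_component Rs \<gamma>s)"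
        unfolding H_def by blast
      show "fs \<in> ?V" by (rule homogeneous_in_listset[OF \<gamma>s(3,1,4)])
      show "Poly_Mapping.keys (prod_list fs) \<subseteq> {\<gamma>}"
        using keys_prod_list_homogeneous[OF \<gamma>s(1,4)] by (simp only: \<gamma>s(2))
    qed
    then have HV: "free_space H \<subseteq> free_space ?V" by (auto simp: free_space_def)
    show ?thesis
    proof
      show "coha_mult_map Q ` coha_tensor_component Rs \<gamma> \<subseteq> coha_component Q \<gamma>"
      proof (clarsimp simp: comp)
        fix x assume x: "x \<in> free_space H"
        have "Poly_Mapping.keys (coha_product x) \<subseteq> {\<gamma>}"
          unfolding linear_extension_def using x H(2) keys_coha_scale
          by (intro order.trans[OF keys_sum] UN_least) (fastforce simp: free_space_def)
        moreover have "x \<in> free_space ?V" using x HV by blast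
        ultimately show "coha_mult_map Q (?cls x) \<in> coha_component Q \<gamma>"
          by (simp add: \<Phi> product_in coha_component_eq[OF \<gamma>])
      qed
      show "coha_component Q \<gamma> \<subseteq> coha_mult_map Q ` coha_tensor_component Rs \<gamma>"
      proof
        fix F assume F: "F \<in> coha_component Q \<gamma>"
        then obtain p where p: "F = Poly_Mapping.single \<gamma> p" "p \<in> coha_deg Q \<gamma>"
          by (auto simp: coha_component_def)
        have FQ: "F \<in> coha Q" using F by (simp add: coha_component_eq[OF \<gamma>])
        have "splitting (map verts Rs) F \<in> free_space H"
          unfolding p(1) H_def using \<gamma> p(2)
          by (intro splitting_single_in_free_space; unfold verts)
            (simp_all add: dimvecs_def coha_deg_eq)
        moreover have "F = coha_mult_map Q (?cls (splitting (map verts Rs) F))"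
          using FQ by (simp add: \<Phi> splitting_in section_product)
        ultimately show "F \<in> coha_mult_map Q ` coha_tensor_component Rs \<gamma>"
          unfolding comp by blast
      qed
    qed
  qed
  have add: "coha_mult_map Q (tensor_plus T U) = coha_mult_map Q T + coha_mult_map Q U"
    if "T \<in> coha_tensor Rs" "U \<in> coha_tensor Rs" for T U
    using that by (auto simp: tensor tensor_plus_class \<Phi> free.subspace_add[OF subspace_free_space]
        module_hom.add[OF module_hom_coha_product])
  have scale: "coha_mult_map Q (tensor_scale coha_scale (map coha Rs) c T) =
      coha_scale c (coha_mult_map Q T)" if "T \<in> coha_tensor Rs" for c T
    using that by (auto simp: tensor tensor_scale_class \<Phi> free.subspace_scale[OF subspace_free_space]
        module_hom.scale[OF module_hom_coha_product])
  show ?thesis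
    using add scale bij graded by (simp add: coha_graded_iso_def)
qed

end

text \<open>An arrow between different blocks belongs to no block, hence survives the contraction and is subject
  to the ordering: its head lies in the earlier block.\<close>

lemma ordered_partition_arcs:
  assumes part: "subquiver_partition Q Qs" and ord: "ordered_partition Q Qs"
    and ij: "i < j" "j < length Qs"
    and a: "a \<in> arcs Q" "tail Q a \<in> verts (Qs ! i)"
  shows "head Q a \<notin> verts (Qs ! j)"
proof
  assume h: "head Q a \<in> verts (Qs ! j)"
  have disj: "verts (Qs ! k) \<inter> verts (Qs ! l) = {}" if "k < length Qs" "l < length Qs" "k \<noteq> l" for k l
    using part that by (simp add: subquiver_partition_def)
  have block: "block_of Qs v = Qs ! k" if "k < length Qs" "v \<in> verts (Qs ! k)" for v k
    unfolding block_of_def using that disj by (intro the_equality) (auto simp: in_set_conv_nth)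
  have "a \<notin> arcs R" if R: "R \<in> set Qs" for R
  proof
    assume aR: "a \<in> arcs R"
    have "subgraph R Q" using part R by (simp add: subquiver_partition_def)
    then have "tail Q a = tail R a" "head Q a = head R a" "wf_digraph R"
      by (auto simp: subgraph_def compatible_def)
    then have "tail Q a \<in> verts R" "head Q a \<in> verts R"
      using aR by (auto simp: wf_digraph_def)
    moreover obtain k where "k < length Qs" "R = Qs ! k" using R by (auto simp: in_set_conv_nth)
    ultimately show False using a h ij disj[of k i] disj[of k j] by auto
  qed
  then have "a \<in> arcs (contracted_quiver Q Qs)" using a by (simp add: contracted_quiver_def)
  moreover have "head (contracted_quiver Q Qs) a = Qs ! j" "tail (contracted_quiver Q Qs) a = Qs ! i"
    using ij a h by (auto simp: contracted_quiver_def block)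
  ultimately have "j < i" using ord ij by (auto simp: ordered_partition_def)
  then show False using ij by simp
qed

theorem corollary6p6:
  fixes Q :: "('v::linorder, 'a) pre_digraph"
    and Qs :: "('v, 'a) pre_digraph list"
  assumes "fin_digraph Q"
    and "acyclic_quiver Q"
    and "subquiver_partition Q Qs"
    and "admissible_partition Q Qs"
    and "ordered_partition Q Qs"
    and "dynkin_partition Qs"
    and "\<forall>R \<in> set Qs. \<not> orientation_of R (DynE 8)"
    and "\<forall>R \<in> set Qs. of_type_E R \<longrightarrow>
           (\<forall>\<delta> \<in> dimvecs R. \<forall>\<phi> \<in> quiver_reps R \<delta>.
              rational_singularities (rep_coords R \<delta>) (orbit_closure R \<delta> \<phi>))"
  shows "coha_graded_iso Q Qs (coha_mult_map Q) \<and>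
         (\<forall>fs \<in> listset (map coha Qs).
            coha_mult_map Q (pure_tensor coha_scale (map coha Qs) fs) = coha_multifactor Q fs)"
proof -
  interpret Q: fin_digraph Q by fact
  have verts: "\<Union>(set (map verts Qs)) = verts Q"
    using assms(3) by (simp add: subquiver_partition_def)
  have disj: "verts (Qs ! i) \<inter> verts (Qs ! j) = {}" if "i < j" "j < length Qs" for i j
    using assms(3) that by (simp add: subquiver_partition_def)
  have sorted: "sorted_wrt (\<lambda>A B. A \<inter> B = {} \<and>
      (\<forall>a\<in>arcs Q. tail Q a \<in> A \<longrightarrow> head Q a \<notin> B)) (map verts Qs)"
    using disj ordered_partition_arcs[OF assms(3,5)] by (auto simp: sorted_wrt_iff_nth_less)
  interpret disjoint_blocks Qs
  proof
    show "finite (verts R)" if "R \<in> set Qs" for R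
      using that verts by (intro finite_subset[OF _ Q.finite_verts]) auto
    show "sorted_wrt (\<lambda>A B. A \<inter> B = {}) (map verts Qs)"
      by (rule sorted_wrt_mono_rel[OF _ sorted]) simp
  qed
  have mult: "coha_multifactor Q fs = prod_list fs" if "fs \<in> listset (map coha Qs)" for fs
    by (rule coha_multifactor_disjoint[OF Q.wf_digraph_axioms listset_coha_supported[OF that] sorted])
      (simp only: verts order_refl)
  have "coha_mult_map Q (pure_tensor coha_scale (map coha Qs) fs) = coha_multifactor Q fs"
    if "fs \<in> listset (map coha Qs)" for fs
    using that unfolding pure_tensor_def
    by (simp add: coha_mult_map_class[OF mult] mult single_in_free_space
        linear_extension_single[OF coha.module_axioms])
  with coha_graded_iso_if_multifactor_eq_prod_list[OF mult verts] show ?thesis by blast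
qed

end
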